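(* Let $r>r_0\ge 2$ and let $F$ be an $r_0$-graph such that there exist positive functions $M_{r_0}=M_{r_0}(n)$, $\gamma_{r_0}=\gamma_{r_0}(n)$ and $\tau_{r_0}=\tau_{r_0}(n,m)$ with the following properties: (a) $F$ is $(M_{r_0},\gamma_{r_0},\tau_{r_0})$-balanced; (b) for sufficiently large $n$, the function $M_{r_0}(n)\,n^{-\frac{r-r_0}{r-1}}$ is non-decreasing with respect to $n$; (c) for sufficiently large $n$, the function $\gamma_{r_0}(n)$ is non-decreasing with respect to $n$; (d) for sufficiently large $n$, $m\ge M_{r_0}(n)$, and any real $x\ge 1$, the function $\tau_{r_0}(n,m)$ is non-increasing with respect to $m$ and $\tau_{r_0}(nx,mx^{\frac{r-r_0}{r-1}})$ is non-decreasing with respect to $x$. Then there exists a sufficiently large constant $C$ depending only on $F$ and $r$ such that for the functions $$M_r(n):=\max\left\{M_{r_0}(n)^{\frac{r-1}{r_0-1}}n^{-\frac{r-r_0}{r_0-1}},\ n^{r-1}\right\}(\log n)^{C},\qquad \gamma_r(n):=\gamma_{r_0}(n)(\log n)^{C},$$ $$\tau_r(n,m):=\tau_{r_0}\left(n,\ n^{\frac{r-r_0}{r-1}}m^{\frac{r_0-1}{r-1}}(\log n)^{-C}\right)(\log n)^{C},$$ the expansion $F^{(r)}$ is $(M_r,\gamma_r,\tau_r)$-balanced.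
   Context: An $r$-graph is a finite $r$-uniform hypergraph; $|F|$ is the number of edges of $F$. For an $r_0$-graph $F$ and $r\ge r_0$, the expansion $F^{(r)}$ is the $r$-graph obtained by inserting $r-r_0$ new vertices into each edge of $F$, all new vertices (over all edges) being distinct. For a hypergraph $\mathcal{H}$ and $S\subseteq V(\mathcal{H})$, $\deg_{\mathcal{H}}(S)$ is the number of edges of $\mathcal{H}$ containing $S$, and $\Delta_i(\mathcal{H})=\max\{\deg_{\mathcal{H}}(S): S\subseteq V(\mathcal{H}),|S|=i\}$. Given positive functions $M=M(n)$, $\gamma=\gamma(n)$, $\tau=\tau(n,m)$ (functions of real arguments), an $r$-graph $F$ is $(M,\gamma,\tau)$-balanced if for every $n$-vertex $m$-edge $r$-graph $H$ with $n$ sufficiently large and $m\ge M(n)$, there exists a non-empty collection $\mathcal{H}$ of copies of $F$ in $H$ (viewed as an $|F|$-uniform hypergraph on vertex set $E(H)$) such that for all integers $1\le i\le |F|$, $$\Delta_i(\mathcal{H})\le \frac{\gamma(n)|\mathcal{H}|}{m}\left(\frac{\tau(n,m)}{m}\right)^{i-1}.$$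
   Formalization: In (d), for sufficiently large n, τ_{r0}(n,m) is required to be non-increasing in m over all m>0, not only for m≥M_{r0}(n); with the restricted range the claim is false, since τ_r evaluates τ_{r0} below M_{r0}(n). *)

theory Defs
  imports Complex_Main
begin

record 'a hypergraph =
  verts :: "'a set"
  edges :: "'a set set"

definition rgraph :: "nat \<Rightarrow> 'a hypergraph \<Rightarrow> bool" where
  "rgraph r H \<longleftrightarrow> finite (verts H) \<and> (\<forall>e\<in>edges H. e \<subseteq> verts H \<and> card e = r)"

definition deg :: "'a hypergraph \<Rightarrow> 'a set \<Rightarrow> nat" where
  "deg H S = card {e \<in> edges H. S \<subseteq> e}"

definition max_deg :: "nat \<Rightarrow> 'a hypergraph \<Rightarrow> nat" where
  "max_deg i H = Max (deg H ` {S. S \<subseteq> verts H \<and> card S = i})"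

text \<open>The new vertices inserted into the edge \<open>e\<close> are the \<open>Inr (e, j)\<close> with \<open>j < r - r0\<close>;
  isolated vertices of \<open>F\<close> are kept.\<close>

definition expansion :: "nat \<Rightarrow> nat \<Rightarrow> 'a hypergraph \<Rightarrow> ('a + 'a set \<times> nat) hypergraph" where
  "expansion r0 r F =
     \<lparr>verts = Inl ` verts F \<union> Inr ` (edges F \<times> {..<r - r0}),
      edges = (\<lambda>e. Inl ` e \<union> Inr ` ({e} \<times> {..<r - r0})) ` edges F\<rparr>"

text \<open>A copy of \<open>F\<close> in \<open>H\<close> is recorded by its edge set, a set of \<open>card (edges F)\<close> edges of \<open>H\<close>,
  so that a set of copies is the edge set of a hypergraph with vertex set \<open>edges H\<close>.\<close>

definition copies :: "'a hypergraph \<Rightarrow> 'b hypergraph \<Rightarrow> 'b set set set" where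
  "copies F H =
     {(\<lambda>e. f ` e) ` edges F | f. inj_on f (verts F) \<and> f ` verts F \<subseteq> verts H \<and>
                                 (\<forall>e\<in>edges F. f ` e \<in> edges H)}"

text \<open>As the host graphs are finite, letting their vertices be natural numbers covers all of them
  up to isomorphism. When the collection \<open>\<C>\<close> is nonempty and \<open>1 \<le> i \<le> card (edges F)\<close>, the
  maximum in \<^const>\<open>max_deg\<close> ranges over a nonempty finite set.\<close>

definition balanced ::
  "nat \<Rightarrow> (real \<Rightarrow> real) \<Rightarrow> (real \<Rightarrow> real) \<Rightarrow> (real \<Rightarrow> real \<Rightarrow> real) \<Rightarrow> 'a hypergraph \<Rightarrow> bool" where
  "balanced r M \<gamma> \<tau> F \<longleftrightarrow>
     (\<forall>\<^sub>F n in sequentially. \<forall>(H :: nat hypergraph) m.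
        rgraph r H \<and> card (verts H) = n \<and> card (edges H) = m \<and> real m \<ge> M (real n) \<longrightarrow>
        (\<exists>\<C>. \<C> \<noteq> {} \<and> \<C> \<subseteq> copies F H \<and>
             (\<forall>i\<in>{1..card (edges F)}.
                real (max_deg i \<lparr>verts = edges H, edges = \<C>\<rparr>)
                  \<le> \<gamma> (real n) * real (card \<C>) / real m
                     * (\<tau> (real n) (real m) / real m) ^ (i - 1))))"

lemma rgraph_expansion:
  assumes "rgraph r0 F" "0 < r0" "r0 \<le> r"
  shows "rgraph r (expansion r0 r F)"
proof -
  have fin: "finite (edges F)"
    using assms(1) by (auto simp: rgraph_def intro: finite_subset[of _ "Pow (verts F)"])
  have "card (Inl ` e \<union> Inr ` ({e} \<times> {..<r - r0}) :: ('a + 'a set \<times> nat) set) = r"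
    if "e \<in> edges F" for e
  proof -
    have "finite e" "card e = r0"
      using that assms by (auto simp: rgraph_def intro: finite_subset)
    then show ?thesis
      using assms(3)
      by (subst card_Un_disjoint) (auto simp: card_image card_cartesian_product)
  qed
  then show ?thesis
    using assms(1) fin by (fastforce simp: rgraph_def expansion_def)
qed

end

theory Submission
  imports Defs "HOL-Library.FuncSet" "HOL-Library.Discrete_Functions"
begin

text \<open>The copies of \<open>F\<^sup>(\<^sup>r\<^sup>)\<close> in an \<open>r\<close>-graph \<open>H\<close> are found by looking at a well-chosen \<open>r0\<close>-uniform
shadow \<open>G\<close> of \<open>H\<close>: balancedness of \<open>F\<close> supplies many well-spread copies of \<open>F\<close> in \<open>G\<close>, and each
edge of such a copy is extended back to an edge of \<open>H\<close>. Both steps cost only factors that are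
polynomial in \<open>ln n\<close>, provided that \<open>H\<close> is regular enough and \<open>G\<close> is large enough.

\<^bold>\<open>Regularity.\<close> A vertex colouring with \<open>r\<close> colours makes a constant fraction of the edges rainbow,
so every edge has a projection to each set \<open>J\<close> of colours. Sorting edges by the dyadic sizes of
the degrees of all their projections, and keeping the most popular class, gives a subgraph in which,
for every \<open>J\<close>, the largest degree of a \<open>J\<close>-projection is within a polylogarithmic factor of
the average one (\<open>dyadic_regularisation\<close>). As \<open>H\<close> has far more than \<open>n\<^sup>r\<^sup>-\<^sup>1\<close> edges, all
\<open>(r-1)\<close>-sets contained in an edge can be assumed to lie in many edges (\<open>min_degree_subfamily\<close>).

\<^bold>\<open>A large shadow.\<close> Write \<open>s J\<close> for the number of \<open>J\<close>-projections. In a regular family \<open>ln (s J)\<close> is,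
up to an additive error, the entropy of the \<open>J\<close>-projection of a random edge, and hence it is almost
submodular in \<open>J\<close> (\<open>shadow_submodular\<close>, proved by counting). As in Han's inequality, adding
colours greedily to the colour \<open>j0\<close> of the largest vertex class yields a set \<open>I\<close> of \<open>r0\<close> colours with
\<open>s I\<close> at least about \<open>u powr \<alpha> * m powr \<beta>\<close>, where \<open>u\<close> is the number of vertices in use,
\<open>\<alpha> = (r - r0) / (r - 1)\<close> and \<open>\<beta> = (r0 - 1) / (r - 1)\<close> (\<open>large_projection\<close>). That \<open>u\<close> may be much
smaller than \<open>n\<close> is why the hypotheses speak about monotonicity along \<open>(n x, m x powr \<alpha>)\<close>: they carry
the bounds for \<open>u\<close> vertices over to \<open>n\<close> vertices.

\<^bold>\<open>Lifting.\<close> Every edge of \<open>G\<close> has between \<open>d\<close> and \<open>2 P d\<close> extensions to \<open>H\<close>, with \<open>P\<close>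
polylogarithmic, and at least half of them avoid any given bounded set of vertices
(\<open>many_extensions_avoid\<close>). So each of the \<open>c\<close> chosen copies of \<open>F\<close> extends in at least
\<open>(d / 2) ^ k\<close> ways to a copy of the expansion, \<open>k\<close> being the number of edges of \<open>F\<close>, while \<open>i\<close> edges
that are already given leave at most \<open>(2 P d) ^ (k - i)\<close> ways per copy of \<open>F\<close> (\<open>lift_copies\<close>). Since
\<open>H\<close> has about \<open>d\<close> times as many edges as \<open>G\<close>, the degree conditions for \<open>G\<close> become those for \<open>H\<close>.\<close>

section \<open>Rainbow and regular subfamilies\<close>

text \<open>In a uniformly random colouring with \<open>r\<close> colours an edge is rainbow with probability at least
\<open>1 / r ^ r\<close>, because already one prescribed bijection to the colours has this probability; so some
colouring does as well as the average.\<close>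

lemma rainbow_subfamily:
  fixes V :: "'b set"
  assumes "finite V" "0 < r" and A: "\<And>e. e \<in> A \<Longrightarrow> e \<subseteq> V \<and> card e = r"
  obtains \<chi> :: "'b \<Rightarrow> nat"
  where "card A \<le> r ^ r * card {e \<in> A. bij_betw \<chi> e {..<r}}"
proof (rule ccontr)
  assume no: "\<not> thesis"
  define \<Phi> where "\<Phi> = PiE V (\<lambda>_. {..<r})"
  have fin: "finite \<Phi>" "finite A"
    using assms by (auto simp: \<Phi>_def intro: finite_PiE finite_subset[of _ "Pow V"])
  have card\<Phi>: "card \<Phi> = r ^ card V"
    using assms(1) by (simp add: \<Phi>_def card_PiE)
  have lower: "card \<Phi> \<le> r ^ r * card {\<chi> \<in> \<Phi>. bij_betw \<chi> e {..<r}}" if "e \<in> A" for e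
  proof -
    have e: "e \<subseteq> V" "card e = r" "finite e"
      using A[OF that] assms(1) by (auto intro: finite_subset)
    obtain g where g: "bij_betw g e {..<r}"
      using e ex_bij_betw_finite_nat[OF e(3)] by (auto simp: atLeast0LessThan)
    define ext where "ext \<phi> = (\<lambda>x. if x \<in> e then g x else \<phi> x)" for \<phi> :: "'b \<Rightarrow> nat"
    have "ext ` PiE (V - e) (\<lambda>_. {..<r}) \<subseteq> {\<chi> \<in> \<Phi>. bij_betw \<chi> e {..<r}}"
    proof safe
      fix \<phi> assume \<phi>: "\<phi> \<in> PiE (V - e) (\<lambda>_. {..<r})"
      show "ext \<phi> \<in> \<Phi>"
        using \<phi> e g by (fastforce simp: ext_def \<Phi>_def PiE_def extensional_def Pi_def bij_betw_def)
      show "bij_betw (ext \<phi>) e {..<r}"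
        using g by (subst bij_betw_cong[of _ _ g]) (auto simp: ext_def)
    qed
    moreover have "inj_on ext (PiE (V - e) (\<lambda>_. {..<r}))"
    proof (rule inj_onI)
      fix \<phi> \<psi> assume h: "\<phi> \<in> PiE (V - e) (\<lambda>_. {..<r})" "\<psi> \<in> PiE (V - e) (\<lambda>_. {..<r})"
        "ext \<phi> = ext \<psi>"
      show "\<phi> = \<psi>"
      proof (rule PiE_ext[OF h(1,2)])
        fix x assume "x \<in> V - e"
        then show "\<phi> x = \<psi> x" using fun_cong[OF h(3), of x] by (simp add: ext_def)
      qed
    qed
    ultimately have "card (PiE (V - e) (\<lambda>_. {..<r})) \<le> card {\<chi> \<in> \<Phi>. bij_betw \<chi> e {..<r}}"
      using fin by (intro card_inj_on_le[of ext]) auto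
    moreover have "card (PiE (V - e) (\<lambda>_. {..<r})) = r ^ (card V - r)"
      using assms(1) e by (simp add: card_PiE card_Diff_subset)
    moreover have "r ^ card V = r ^ r * r ^ (card V - r)"
      using card_mono[OF assms(1) e(1)] e(2) by (simp flip: power_add)
    ultimately show ?thesis using card\<Phi> by simp
  qed
  have "card A * card \<Phi> \<le> (\<Sum>e\<in>A. r ^ r * card {\<chi> \<in> \<Phi>. bij_betw \<chi> e {..<r}})"
    using sum_bounded_below[of A "card \<Phi>", OF lower] by simp
  also have "\<dots> = r ^ r * (\<Sum>\<chi>\<in>\<Phi>. card {e \<in> A. bij_betw \<chi> e {..<r}})"
    using sum_multicount_gen[of \<Phi> A "\<lambda>\<chi> e. bij_betw \<chi> e {..<r}"
        "\<lambda>e. card {\<chi> \<in> \<Phi>. bij_betw \<chi> e {..<r}}"] fin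
    by (simp flip: sum_distrib_left)
  also have "\<dots> = (\<Sum>\<chi>\<in>\<Phi>. r ^ r * card {e \<in> A. bij_betw \<chi> e {..<r}})"
    by (simp add: sum_distrib_left)
  also have "\<dots> < (\<Sum>\<chi>\<in>\<Phi>. card A)"
  proof (rule sum_strict_mono)
    show "finite \<Phi>" by (rule fin)
    show "\<Phi> \<noteq> {}"
      using card\<Phi> \<open>0 < r\<close> by (metis card.empty power_eq_0_iff less_irrefl)
    show "r ^ r * card {e \<in> A. bij_betw \<chi> e {..<r}} < card A" if "\<chi> \<in> \<Phi>" for \<chi>
      using no \<open>\<And>\<chi>. card A \<le> r ^ r * card {e \<in> A. bij_betw \<chi> e {..<r}} \<Longrightarrow> thesis\<close> not_le by blast
  qed
  finally show False by simp
qed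

lemma card_eq_sum_fibres:
  assumes "finite A"
  shows "card A = (\<Sum>S\<in>p ` A. card {e \<in> A. p e = S})"
  using sum.group[of A "p ` A" p "\<lambda>_. 1 :: nat"] assms by simp

text \<open>Edges are classified by the dyadic sizes of the degrees, in \<open>A\<close>, of all their images \<open>p J e\<close>; there are at
most \<open>\<Lambda> ^ card \<J>\<close> classes, and \<open>B\<close> is the largest. Passing to \<open>B\<close> can only lower degrees, which is
harmless as only an upper bound is claimed: degrees are below \<open>2 ^ (l + 1)\<close>, while there are at most
\<open>card A / 2 ^ l\<close> images because each of them had degree at least \<open>2 ^ l\<close> in \<open>A\<close>. The conclusion survives,
up to the factor lost, any further passage to a subfamily.\<close>

lemma dyadic_regularisation:
  fixes p :: "'i \<Rightarrow> 'e \<Rightarrow> 's"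
  assumes "finite A" "finite \<J>" and \<Lambda>: "card A < 2 ^ \<Lambda>"
  obtains B where "B \<subseteq> A" "card A \<le> \<Lambda> ^ card \<J> * card B"
    "\<And>J e. J \<in> \<J> \<Longrightarrow> e \<in> B \<Longrightarrow> card {e' \<in> B. p J e' = p J e} * card (p J ` B) \<le> 2 * card A"
proof -
  define dg where "dg J S = card {e' \<in> A. p J e' = S}" for J S
  define \<kappa> where "\<kappa> e = (\<lambda>J\<in>\<J>. floor_log (dg J (p J e)))" for e
  have dgpos: "0 < dg J (p J e)" if "e \<in> A" for J e
    using that assms(1) by (auto simp: dg_def card_gt_0_iff)
  have "dg J S \<le> card A" for J S
    unfolding dg_def using assms(1) by (intro card_mono) auto
  then have lt: "floor_log (dg J (p J e)) < \<Lambda>" if "e \<in> A" for J e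
    using floor_log_exp2_le[OF dgpos[OF that], of J] \<Lambda>
      by (metis le_less_trans less_exp one_less_numeral_iff power_less_imp_less_exp semiring_norm(76))
  have \<kappa>: "\<kappa> ` A \<subseteq> PiE \<J> (\<lambda>_. {..<\<Lambda>})"
    using lt by (auto simp: \<kappa>_def)
  have fin: "finite (\<kappa> ` A)" using assms(1) by simp
  obtain c where c: "card A \<le> \<Lambda> ^ card \<J> * card {e \<in> A. \<kappa> e = c}"
  proof (rule ccontr)
    assume no: "\<not> thesis"
    have ne: "A \<noteq> {}" using no that by force
    have small: "\<Lambda> ^ card \<J> * card {e \<in> A. \<kappa> e = c} < card A" for c
      using that[of c] no not_le by blast
    have "\<Lambda> ^ card \<J> * card A = (\<Sum>c\<in>\<kappa> ` A. \<Lambda> ^ card \<J> * card {e \<in> A. \<kappa> e = c})"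
      by (subst card_eq_sum_fibres[OF assms(1), of \<kappa>]) (simp add: sum_distrib_left)
    also have "\<dots> < (\<Sum>c\<in>\<kappa> ` A. card A)"
      using small ne fin by (intro sum_strict_mono) auto
    also have "\<dots> = card (\<kappa> ` A) * card A" by simp
    also have "\<dots> \<le> \<Lambda> ^ card \<J> * card A"
      using card_mono[OF _ \<kappa>] assms(2) by (simp add: finite_PiE card_PiE)
    finally show False by simp
  qed
  define B where "B = {e \<in> A. \<kappa> e = c}"
  have "card {e' \<in> B. p J e' = p J e} * card (p J ` B) \<le> 2 * card A" if J: "J \<in> \<J>" and e: "e \<in> B" for J e
  proof -
    have lev: "floor_log (dg J (p J e')) = c J" if "e' \<in> B" for e'
      using that J by (auto simp: B_def \<kappa>_def)
    have "card {e' \<in> B. p J e' = p J e} \<le> dg J (p J e)"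
      unfolding dg_def using assms(1) by (intro card_mono) (auto simp: B_def)
    also have "\<dots> \<le> 2 * 2 ^ c J"
      using floor_log_exp2_gt[of "dg J (p J e)"] lev[OF e] by simp
    finally have 1: "card {e' \<in> B. p J e' = p J e} \<le> 2 * 2 ^ c J" .
    have "card (p J ` B) * 2 ^ c J \<le> (\<Sum>S\<in>p J ` B. dg J S)"
    proof -
      have "2 ^ c J \<le> dg J S" if "S \<in> p J ` B" for S
      proof -
        obtain e' where "e' \<in> B" "S = p J e'" using \<open>S \<in> p J ` B\<close> by auto
        then show ?thesis
          using lev[of e'] floor_log_exp2_le[OF dgpos[of e' J]] by (simp add: B_def)
      qed
      then show ?thesis using sum_bounded_below[of "p J ` B" "2 ^ c J" "dg J"] by simp
    qed
    also have "\<dots> \<le> (\<Sum>S\<in>p J ` A. dg J S)"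
      using assms(1) by (intro sum_mono2) (auto simp: B_def)
    also have "\<dots> = card A"
      using card_eq_sum_fibres[OF assms(1), of "p J"] by (simp add: dg_def)
    finally have 2: "card (p J ` B) * 2 ^ c J \<le> card A" .
    have "card {e' \<in> B. p J e' = p J e} * card (p J ` B) \<le> 2 * 2 ^ c J * card (p J ` B)"
      using 1 by (rule mult_right_mono) simp
    also have "\<dots> \<le> 2 * card A" using 2 by (simp add: mult.commute)
    finally show ?thesis .
  qed
  then show thesis using that[of B] c by (auto simp: B_def)
qed

text \<open>Instead of deleting low-degree fibres one after the other, \<open>B\<close> is chosen to maximise its size minus \<open>K\<close> times
the total number of images. Deleting a fibre of size below \<open>K\<close> would lower the size by less than \<open>K\<close> and the
number of images by at least one, so a maximiser has no such fibre.\<close>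

lemma min_degree_subfamily:
  fixes q :: "'i \<Rightarrow> 'e \<Rightarrow> 's"
  assumes "finite A" "finite \<J>"
  obtains B where "B \<subseteq> A" "\<And>j e. j \<in> \<J> \<Longrightarrow> e \<in> B \<Longrightarrow> K \<le> card {e' \<in> B. q j e' = q j e}"
    "card A \<le> card B + K * (\<Sum>j\<in>\<J>. card (q j ` A))"
proof -
  define val where "val B = int (card B) - int K * (\<Sum>j\<in>\<J>. int (card (q j ` B)))" for B
  have fP: "finite (Pow A)" using assms(1) by simp
  obtain B where B: "B \<subseteq> A" and max: "\<And>B'. B' \<subseteq> A \<Longrightarrow> val B' \<le> val B"
  proof -
    have "Max (val ` Pow A) \<in> val ` Pow A" using fP by (intro Max_in) auto
    then obtain B where "B \<subseteq> A" "val B = Max (val ` Pow A)" by auto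
    then show thesis using that[of B] fP by (auto intro!: Max_ge)
  qed
  have finB: "finite B" using B assms(1) by (rule finite_subset)
  have "K \<le> card {e' \<in> B. q j e' = q j e}" if j: "j \<in> \<J>" and e: "e \<in> B" for j e
  proof (rule ccontr)
    assume small: "\<not> K \<le> card {e' \<in> B. q j e' = q j e}"
    define X where "X = {e' \<in> B. q j e' = q j e}"
    have X: "card X < K" "X \<subseteq> B" using small by (auto simp: X_def)
    have "card (B - X) = card B - card X" "card X \<le> card B"
      using X finB by (auto intro: card_Diff_subset card_mono finite_subset)
    then have cB: "int (card (B - X)) = int (card B) - int (card X)" by simp
    have "q j e \<notin> q j ` (B - X)" "q j e \<in> q j ` B"
      using e by (auto simp: X_def)
    then have "q j ` (B - X) \<subset> q j ` B"
      by blast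
    then have strict: "card (q j ` (B - X)) < card (q j ` B)"
      using finB by (intro psubset_card_mono) auto
    have "(\<Sum>i\<in>\<J>. int (card (q i ` (B - X)))) < (\<Sum>i\<in>\<J>. int (card (q i ` B)))"
      using strict j assms(2) finB
      by (intro sum_strict_mono_ex1) (auto intro!: card_mono bexI[of _ j])
    then have "(\<Sum>i\<in>\<J>. int (card (q i ` (B - X)))) + 1 \<le> (\<Sum>i\<in>\<J>. int (card (q i ` B)))" by simp
    then have "int K * ((\<Sum>i\<in>\<J>. int (card (q i ` (B - X)))) + 1) \<le> int K * (\<Sum>i\<in>\<J>. int (card (q i ` B)))"
      by (intro mult_left_mono) auto
    then have "val B < val (B - X)"
      using X(1) cB by (simp add: val_def algebra_simps)
    moreover have "val (B - X) \<le> val B" using B by (intro max) auto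
    ultimately show False by simp
  qed
  moreover have "card A \<le> card B + K * (\<Sum>j\<in>\<J>. card (q j ` A))"
  proof -
    have "int (card A) - int K * (\<Sum>j\<in>\<J>. int (card (q j ` A))) \<le> int (card B) - int K * (\<Sum>j\<in>\<J>. int (card (q j ` B)))"
      using max[of A] by (simp add: val_def)
    moreover have "0 \<le> int K * (\<Sum>j\<in>\<J>. int (card (q j ` B)))"
      by (intro mult_nonneg_nonneg sum_nonneg) auto
    ultimately have "int (card A) \<le> int (card B + K * (\<Sum>j\<in>\<J>. card (q j ` A)))"
      by simp
    then show ?thesis by linarith
  qed
  ultimately show thesis using that B by blast
qed

lemma card_low_degree:
  fixes t :: real
  assumes "finite A" "0 \<le> t"
  shows "real (card {e \<in> A. real (card {e' \<in> A. p e' = p e}) < t}) \<le> t * real (card (p ` A))"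
proof -
  define X where "X = {e \<in> A. real (card {e' \<in> A. p e' = p e}) < t}"
  have finX: "finite X" using assms by (simp add: X_def)
  have "real (card X) = (\<Sum>S\<in>p ` X. real (card {e \<in> X. p e = S}))"
    by (subst card_eq_sum_fibres[OF finX, of p]) simp
  also have "\<dots> \<le> (\<Sum>S\<in>p ` X. t)"
  proof (rule sum_mono)
    fix S assume "S \<in> p ` X"
    then obtain e where e: "e \<in> X" "S = p e" by auto
    have "card {e' \<in> X. p e' = S} \<le> card {e' \<in> A. p e' = p e}"
      using assms e by (intro card_mono) (auto simp: X_def)
    then show "real (card {e' \<in> X. p e' = S}) \<le> t"
      using e by (auto simp: X_def)
  qed
  also have "\<dots> \<le> t * real (card (p ` A))"
    using assms by (auto simp: X_def mult.commute intro!: mult_left_mono card_mono)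
  finally show ?thesis by (simp add: X_def)
qed


section \<open>Projections to sets of colours\<close>

definition proj :: "('b \<Rightarrow> nat) \<Rightarrow> nat set \<Rightarrow> 'b set \<Rightarrow> 'b set" where
  "proj \<chi> J e = {x \<in> e. \<chi> x \<in> J}"

lemma proj_proj: "proj \<chi> I (proj \<chi> J e) = proj \<chi> (I \<inter> J) e"
  by (auto simp: proj_def)

lemma card_proj:
  assumes "bij_betw \<chi> e {..<r}" "J \<subseteq> {..<r}"
  shows "card (proj \<chi> J e) = card J"
proof -
  have "\<chi> ` proj \<chi> J e = J"
    using assms by (auto simp: proj_def bij_betw_def)
  moreover have "inj_on \<chi> (proj \<chi> J e)"
    using assms by (auto simp: proj_def bij_betw_def intro: inj_on_subset)
  ultimately show ?thesis by (metis card_image)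
qed

lemma proj_all: "bij_betw \<chi> e {..<r} \<Longrightarrow> proj \<chi> {..<r} e = e"
  by (auto simp: proj_def bij_betw_def)

text \<open>This is submodularity of entropy, in counting form, for a family that is regular on \<open>X \<union> Y\<close> and on \<open>X \<inter> Y\<close>.
After removing the edges whose \<open>X\<close>- or \<open>Y\<close>-projection has degree far below average, every \<open>(X \<inter> Y)\<close>-set
\<open>z\<close> has at most about \<open>s X / s (X \<inter> Y)\<close> extensions to \<open>X\<close>, and likewise for \<open>Y\<close>; and an
\<open>(X \<union> Y)\<close>-set is determined by a pair of such extensions of the same \<open>z\<close>.\<close>

lemma shadow_submodular:
  fixes A :: "'b set set" and P :: real
  assumes fin: "finite A" and ne: "A \<noteq> {}"
    and reg: "\<And>J e. J \<in> {X \<union> Y, X \<inter> Y} \<Longrightarrow> e \<in> A \<Longrightarrow>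
       real (card {e' \<in> A. proj \<chi> J e' = proj \<chi> J e}) * real (card (proj \<chi> J ` A)) \<le> P * real (card A)"
  shows "real (card (proj \<chi> (X \<union> Y) ` A)) * real (card (proj \<chi> (X \<inter> Y) ` A))
    \<le> 32 * P ^ 3 * real (card (proj \<chi> X ` A)) * real (card (proj \<chi> Y ` A))"
proof -
  define a where "a = real (card A)"
  define s where "s J = real (card (proj \<chi> J ` A))" for J
  define dg where "dg J S = real (card {e \<in> A. proj \<chi> J e = S})" for J S
  have apos: "a > 0" using fin ne by (simp add: a_def card_gt_0_iff)
  have spos: "s J > 0" for J using fin ne by (simp add: s_def card_gt_0_iff)
  have dgpos: "dg J (proj \<chi> J e) > 0" if "e \<in> A" for J e
    using fin that by (auto simp: dg_def card_gt_0_iff)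
  have reg': "dg J (proj \<chi> J e) \<le> P * a / s J" if "J \<in> {X \<union> Y, X \<inter> Y}" "e \<in> A" for J e
    using reg[OF that] spos[of J] by (simp add: dg_def s_def a_def field_simps)
  have Ppos: "P > 0"
  proof -
    obtain e where "e \<in> A" using ne by auto
    then have "0 < P * a / s (X \<union> Y)"
      using dgpos[of e "X \<union> Y"] reg'[of "X \<union> Y" e] by simp
    then show ?thesis using apos spos[of "X \<union> Y"] by (simp add: zero_less_divide_iff zero_less_mult_iff)
  qed
  define low where "low J = {e \<in> A. dg J (proj \<chi> J e) < a / (4 * s J)}" for J
  have low: "real (card (low J)) \<le> a / 4" for J
    using card_low_degree[OF fin, of "a / (4 * s J)" "proj \<chi> J"] apos spos[of J]
    by (simp add: low_def dg_def s_def)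
  define E where "E = A - (low X \<union> low Y)"
  have finE: "finite E" "E \<subseteq> A" using fin by (auto simp: E_def)
  have "a / 2 \<le> real (card E)"
  proof -
    have "card A \<le> card ((low X \<union> low Y) \<union> E)"
      using fin by (intro card_mono) (auto simp: E_def low_def)
    moreover have "card ((low X \<union> low Y) \<union> E) \<le> card (low X \<union> low Y) + card E"
      by (rule card_Un_le)
    moreover have "card (low X \<union> low Y) \<le> card (low X) + card (low Y)" by (rule card_Un_le)
    ultimately have "a \<le> real (card (low X)) + real (card (low Y)) + real (card E)"
      by (simp add: a_def)
    then show ?thesis using low[of X] low[of Y] by simp
  qed
  also have "real (card E) \<le> real (card (proj \<chi> (X \<union> Y) ` E)) * (P * a / s (X \<union> Y))"
  proof -
    have "real (card E) = (\<Sum>S\<in>proj \<chi> (X \<union> Y) ` E. real (card {e \<in> E. proj \<chi> (X \<union> Y) e = S}))"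
      by (subst card_eq_sum_fibres[OF finE(1), of "proj \<chi> (X \<union> Y)"]) simp
    also have "\<dots> \<le> (\<Sum>S\<in>proj \<chi> (X \<union> Y) ` E. P * a / s (X \<union> Y))"
    proof (rule sum_mono)
      fix S assume "S \<in> proj \<chi> (X \<union> Y) ` E"
      then obtain e where e: "e \<in> A" "S = proj \<chi> (X \<union> Y) e" using finE by auto
      have "real (card {e \<in> E. proj \<chi> (X \<union> Y) e = S}) \<le> dg (X \<union> Y) S"
        unfolding dg_def using fin finE by (intro of_nat_mono card_mono) auto
      also have "\<dots> \<le> P * a / s (X \<union> Y)" using reg' e by simp
      finally show "real (card {e \<in> E. proj \<chi> (X \<union> Y) e = S}) \<le> P * a / s (X \<union> Y)" .
    qed
    finally show ?thesis by (simp add: mult.commute)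
  qed
  finally have 1: "s (X \<union> Y) \<le> 2 * P * real (card (proj \<chi> (X \<union> Y) ` E))"
    using apos spos[of "X \<union> Y"] by (simp add: field_simps)
  define ext where "ext J z = {S \<in> proj \<chi> J ` E. proj \<chi> (X \<inter> Y) S = z}" for J z
  \<comment> \<open>Every \<open>J\<close>-set in the shadow of \<open>E\<close> lies in many edges, while its \<open>X \<inter> Y\<close>-part
    lies in few; so the latter has few extensions.\<close>
  have ext: "real (card (ext J z)) \<le> 4 * P * s J / s (X \<inter> Y)"
    if J: "J = X \<or> J = Y" and z: "z \<in> proj \<chi> (X \<inter> Y) ` E" for J z
  proof -
    have int: "X \<inter> Y \<inter> J = X \<inter> Y" using J by auto
    have "real (card (ext J z)) * (a / (4 * s J)) \<le> (\<Sum>S\<in>ext J z. dg J S)"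
    proof -
      have "a / (4 * s J) \<le> dg J S" if "S \<in> ext J z" for S
      proof -
        from that obtain e where "e \<in> E" "S = proj \<chi> J e" by (auto simp: ext_def)
        then show ?thesis using J by (auto simp: E_def low_def)
      qed
      then show ?thesis using sum_bounded_below[of "ext J z" "a / (4 * s J)" "dg J"] by simp
    qed
    also have "\<dots> = (\<Sum>S\<in>ext J z. real (card {e \<in> A. proj \<chi> J e = S}))"
      by (simp add: dg_def)
    also have "\<dots> = real (card (\<Union>S\<in>ext J z. {e \<in> A. proj \<chi> J e = S}))"
      using fin finE by (subst card_UN_disjoint) (auto simp: ext_def)
    also have "\<dots> \<le> dg (X \<inter> Y) z"
    proof -
      have part: "proj \<chi> (X \<inter> Y) (proj \<chi> J e) = proj \<chi> (X \<inter> Y) e" for e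
        unfolding proj_proj int ..
      have sub: "(\<Union>S\<in>ext J z. {e \<in> A. proj \<chi> J e = S}) \<subseteq> {e \<in> A. proj \<chi> (X \<inter> Y) e = z}"
      proof
        fix e assume "e \<in> (\<Union>S\<in>ext J z. {e \<in> A. proj \<chi> J e = S})"
        then have "e \<in> A" "proj \<chi> J e \<in> ext J z" by auto
        then show "e \<in> {e \<in> A. proj \<chi> (X \<inter> Y) e = z}" using part[of e] unfolding ext_def by simp
      qed
      show ?thesis
        unfolding dg_def by (intro of_nat_mono card_mono sub) (use fin in simp)
    qed
    also have "\<dots> \<le> P * a / s (X \<inter> Y)"
      using z reg' finE by auto
    finally show ?thesis
      using apos spos[of J] spos[of "X \<inter> Y"] by (simp add: field_simps)
  qed
  have "real (card (proj \<chi> (X \<union> Y) ` E)) \<le> real (card (SIGMA z:proj \<chi> (X \<inter> Y) ` E. ext X z \<times> ext Y z))"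
  proof -
    let ?f = "\<lambda>T. (proj \<chi> (X \<inter> Y) T, proj \<chi> X T, proj \<chi> Y T)"
    have i1: "X \<inter> (X \<union> Y) = X" "Y \<inter> (X \<union> Y) = Y" "X \<inter> Y \<inter> (X \<union> Y) = X \<inter> Y" "X \<inter> Y \<inter> X = X \<inter> Y" "X \<inter> Y \<inter> Y = X \<inter> Y" by auto
    have "?f ` (proj \<chi> (X \<union> Y) ` E) \<subseteq> (SIGMA z:proj \<chi> (X \<inter> Y) ` E. ext X z \<times> ext Y z)"
      by (auto simp: ext_def proj_proj i1)
    moreover have "inj_on ?f (proj \<chi> (X \<union> Y) ` E)"
    proof (rule inj_onI)
      fix T T' assume T: "T \<in> proj \<chi> (X \<union> Y) ` E" "T' \<in> proj \<chi> (X \<union> Y) ` E" and eq: "?f T = ?f T'"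
      have "T = proj \<chi> X T \<union> proj \<chi> Y T" "T' = proj \<chi> X T' \<union> proj \<chi> Y T'"
        using T by (auto simp: proj_def)
      then show "T = T'" using eq by simp
    qed
    ultimately show ?thesis
      using finE by (intro of_nat_mono card_inj_on_le[of ?f]) (auto simp: ext_def)
  qed
  also have "\<dots> = (\<Sum>z\<in>proj \<chi> (X \<inter> Y) ` E. real (card (ext X z)) * real (card (ext Y z)))"
    using finE by (subst card_SigmaI) (auto simp: ext_def card_cartesian_product)
  also have "\<dots> \<le> (\<Sum>z\<in>proj \<chi> (X \<inter> Y) ` E. (4 * P * s X / s (X \<inter> Y)) * (4 * P * s Y / s (X \<inter> Y)))"
    using Ppos spos by (intro sum_mono mult_mono ext) (auto intro!: divide_nonneg_pos mult_nonneg_nonneg less_imp_le)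
  also have "\<dots> \<le> s (X \<inter> Y) * ((4 * P * s X / s (X \<inter> Y)) * (4 * P * s Y / s (X \<inter> Y)))"
  proof -
    have "real (card (proj \<chi> (X \<inter> Y) ` E)) \<le> s (X \<inter> Y)"
      unfolding s_def using fin finE by (intro of_nat_mono card_mono) auto
    then show ?thesis
      unfolding sum_constant using Ppos spos[THEN less_imp_le]
      by (intro mult_right_mono mult_nonneg_nonneg divide_nonneg_nonneg) auto
  qed
  also have "\<dots> = 16 * P^2 * s X * s Y / s (X \<inter> Y)"
    using spos[of "X \<inter> Y"] by (simp add: field_simps power2_eq_square)
  finally have 2: "real (card (proj \<chi> (X \<union> Y) ` E)) \<le> 16 * P^2 * s X * s Y / s (X \<inter> Y)" .
  have "s (X \<union> Y) \<le> 2 * P * (16 * P^2 * s X * s Y / s (X \<inter> Y))"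
    using 1 mult_left_mono[OF 2, of "2 * P"] Ppos by simp
  then show ?thesis
    using spos[of "X \<inter> Y"] unfolding s_def[symmetric] by (simp add: field_simps power3_eq_cube power2_eq_square)
qed

section \<open>A greedy Han inequality\<close>

lemma submodular_subadditive:
  fixes f :: "'i set \<Rightarrow> real"
  assumes sub: "\<And>X Y. X \<subseteq> U \<Longrightarrow> Y \<subseteq> U \<Longrightarrow> f (X \<union> Y) + f (X \<inter> Y) \<le> f X + f Y + \<epsilon>"
    and "finite B" "A \<subseteq> U" "B \<subseteq> U" "A \<inter> B = {}"
  shows "f (A \<union> B) - f A \<le> (\<Sum>j\<in>B. f (insert j A) - f A + \<epsilon>)"
  using assms(2,4,5)
proof (induction B rule: finite_induct)
  case (insert j B)
  have "(A \<union> B) \<union> insert j A = A \<union> insert j B" "(A \<union> B) \<inter> insert j A = A"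
    using insert by auto
  then have "f (A \<union> insert j B) + f A \<le> f (A \<union> B) + f (insert j A) + \<epsilon>"
    using sub[of "A \<union> B" "insert j A"] insert assms(3) by auto
  then show ?case using insert by simp
qed simp

text \<open>By subadditivity some \<open>j\<close> outside \<open>A\<close> gains at least the average share \<open>(f U - f A) / card (U - A)\<close>, up to
\<open>\<epsilon>\<close>. Adding it to \<open>A\<close> and continuing with \<open>k - 1\<close> further elements keeps the total gain at least
proportional to \<open>k\<close>: the gain \<open>d\<close> of the first step enters the final bound with the nonnegative coefficient
\<open>1 - t\<close>, where \<open>t\<close> is the proportion used in the remaining steps.\<close>

lemma submodular_greedy:
  fixes f :: "'i set \<Rightarrow> real"
  assumes sub: "\<And>X Y. X \<subseteq> U \<Longrightarrow> Y \<subseteq> U \<Longrightarrow> f (X \<union> Y) + f (X \<inter> Y) \<le> f X + f Y + \<epsilon>"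
    and U: "finite U" and "\<epsilon> \<ge> 0" and "A \<subseteq> U" "k \<le> card (U - A)"
  shows "\<exists>B \<subseteq> U - A. card B = k \<and>
    real k / real (card (U - A)) * (f U - f A) - real k * \<epsilon> \<le> f (A \<union> B) - f A"
  using assms(4,5)
proof (induction k arbitrary: A)
  case 0
  then show ?case by (intro exI[of _ "{}"]) simp
next
  case (Suc k)
  define q where "q = card (U - A)"
  define X where "X = f U - f A"
  have q: "q \<ge> 1" using Suc by (simp add: q_def)
  have fin: "finite (U - A)" using U by simp
  have ne: "U - A \<noteq> {}" using Suc by auto
  obtain j where j: "j \<in> U - A" "X / q - \<epsilon> \<le> f (insert j A) - f A"
  proof (rule ccontr)
    assume "\<not> thesis"
    then have lt: "f (insert j A) - f A + \<epsilon> < X / q" if "j \<in> U - A" for j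
      using that \<open>\<And>j. j \<in> U - A \<Longrightarrow> X / q - \<epsilon> \<le> f (insert j A) - f A \<Longrightarrow> thesis\<close>[of j] by force
    have "A \<union> (U - A) = U" using Suc by auto
    then have "X \<le> (\<Sum>j\<in>U - A. f (insert j A) - f A + \<epsilon>)"
      using submodular_subadditive[of U f \<epsilon> "U - A" A, OF sub fin] Suc by (auto simp: X_def)
    also have "\<dots> < (\<Sum>j\<in>U - A. X / q)"
      using lt ne fin by (intro sum_strict_mono) auto
    also have "\<dots> = X" using q by (simp add: q_def)
    finally show False by simp
  qed
  have "U - insert j A = (U - A) - {j}" by auto
  then have q': "card (U - insert j A) = q - 1" using j fin by (simp add: q_def)
  have "insert j A \<subseteq> U" "k \<le> card (U - insert j A)"
    using Suc.prems j q' by (auto simp: q_def)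
  then obtain B where B: "B \<subseteq> U - insert j A" "card B = k"
    "real k / real (q - 1) * (f U - f (insert j A)) - real k * \<epsilon> \<le> f (insert j A \<union> B) - f (insert j A)"
    using Suc.IH[of "insert j A"] unfolding q' by blast
  define d where "d = f (insert j A) - f A"
  have finB: "finite B" using B(1) U by (meson finite_Diff finite_subset)
  have kq: "Suc k \<le> q" using Suc by (simp add: q_def)
  have "real (Suc k) / real q * X - real (Suc k) * \<epsilon> \<le> f (A \<union> insert j B) - f A"
  \<comment> \<open>For \<open>q = 1\<close> the proportion \<open>k / (q - 1)\<close> is not meaningful, but then \<open>{j}\<close> is all of \<open>U - A\<close>.\<close>
  proof (cases "q = 1")
    case True
    then have "k = 0" "B = {}" using kq B finB by auto
    then show ?thesis using j(2) True by simp
  next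
    case False
    define t where "t = real k / real (q - 1)"
    have rq: "real (q - 1) = real q - 1" using q by simp
    have q2: "real q > 1" using False q by simp
    have t: "0 \<le> t" "t \<le> 1" using kq q2 by (auto simp: t_def rq field_simps)
    have "(1 - t) * (X / q - \<epsilon>) \<le> (1 - t) * d"
      using t j(2) by (intro mult_left_mono) (auto simp: d_def)
    moreover have "(1 - t) * \<epsilon> \<le> \<epsilon>"
      using t \<open>\<epsilon> \<ge> 0\<close> mult_right_mono[of "1 - t" 1 \<epsilon>] by simp
    ultimately have "(1 - t) * (X / q) - \<epsilon> \<le> (1 - t) * d"
      by (simp add: right_diff_distrib)
    moreover have "(1 - t) * (X / q) + t * X = real (Suc k) / real q * X"
    proof -
      have tq: "t * (real q - 1) = real k" using q2 by (simp add: t_def rq)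
      have "(1 - t) * (X / real q) + t * X = X / real q * (1 + t * (real q - 1))"
        using q2 by (simp add: field_simps)
      then show ?thesis unfolding tq by simp
    qed
    moreover have "t * (X - d) - real k * \<epsilon> \<le> f (insert j A \<union> B) - f (insert j A)"
      using B(3) by (simp add: t_def X_def d_def)
    moreover have "insert j A \<union> B = A \<union> insert j B" by auto
    ultimately show ?thesis by (simp add: d_def algebra_simps)
  qed
  moreover have "insert j B \<subseteq> U - A" "card (insert j B) = Suc k"
    using B j finB by (auto simp: card_insert_if)
  ultimately show ?case unfolding q_def X_def by blast
qed


section \<open>A large shadow\<close>

text \<open>The greedy inequality, applied to the logarithms of the shadow sizes and started from the single colour \<open>j0\<close>.
The resulting bound is stated multiplicatively, the additive error \<open>ln (32 * P ^ 3)\<close> of submodularity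
having been paid once for each of the \<open>r0 - 1\<close> added colours.\<close>

lemma large_projection:
  fixes A :: "'b set set" and P :: real and r0 r :: nat
  assumes fin: "finite A" and ne: "A \<noteq> {}" and rainbow: "\<And>e. e \<in> A \<Longrightarrow> bij_betw \<chi> e {..<r}"
    and P: "P \<ge> 1"
    and reg: "\<And>J e. J \<subseteq> {..<r} \<Longrightarrow> e \<in> A \<Longrightarrow>
       real (card {e' \<in> A. proj \<chi> J e' = proj \<chi> J e}) * real (card (proj \<chi> J ` A)) \<le> P * real (card A)"
    and r0: "1 \<le> r0" "r0 \<le> r" "r \<ge> 2" and j0: "j0 < r"
  obtains I where "I \<subseteq> {..<r}" "j0 \<in> I" "card I = r0"
    "real (card (proj \<chi> {j0} ` A)) powr ((real r - real r0) / (real r - 1))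
      * real (card A) powr ((real r0 - 1) / (real r - 1))
     \<le> (32 * P ^ 3) ^ (r0 - 1) * real (card (proj \<chi> I ` A))"
proof -
  define s where "s J = real (card (proj \<chi> J ` A))" for J
  have spos: "s J > 0" for J using fin ne by (simp add: s_def card_gt_0_iff)
  define c where "c = 32 * P ^ 3"
  have c: "c \<ge> 1" using one_le_power[OF P, of 3] unfolding c_def by linarith
  define \<epsilon> where "\<epsilon> = ln c"
  have \<epsilon>: "\<epsilon> \<ge> 0" using c by (simp add: \<epsilon>_def)
  have "proj \<chi> {..<r} ` A = A"
    using rainbow by (force simp: proj_all)
  then have sU: "s {..<r} = real (card A)" by (simp add: s_def)
  have sub: "ln (s (X \<union> Y)) + ln (s (X \<inter> Y)) \<le> ln (s X) + ln (s Y) + \<epsilon>"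
    if "X \<subseteq> {..<r}" "Y \<subseteq> {..<r}" for X Y
  proof -
    have "s (X \<union> Y) * s (X \<inter> Y) \<le> c * s X * s Y"
      unfolding s_def c_def using that by (intro shadow_submodular fin ne reg) auto
    then have "ln (s (X \<union> Y) * s (X \<inter> Y)) \<le> ln (c * s X * s Y)"
      using spos c by (subst ln_le_cancel_iff) auto
    also have "\<dots> = ln c + ln (s X) + ln (s Y)"
      using spos[of X] spos[of Y] c by (simp add: ln_mult_pos)
    finally show ?thesis using spos by (simp add: ln_mult_pos \<epsilon>_def)
  qed
  have cU: "card ({..<r} - {j0}) = r - 1" using j0 by simp
  obtain B where B: "B \<subseteq> {..<r} - {j0}" "card B = r0 - 1"
    "real (r0 - 1) / real (r - 1) * (ln (s {..<r}) - ln (s {j0})) - real (r0 - 1) * \<epsilon>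
      \<le> ln (s ({j0} \<union> B)) - ln (s {j0})"
  proof -
    have "{j0} \<subseteq> {..<r}" "r0 - 1 \<le> r - 1" using j0 r0 by auto
    then show thesis
      using submodular_greedy[of "{..<r}" "\<lambda>J. ln (s J)" \<epsilon> "{j0}" "r0 - 1", OF sub _ \<epsilon>] that
      unfolding cU by blast
  qed
  define \<beta> where "\<beta> = (real r0 - 1) / (real r - 1)"
  have \<beta>: "real (r0 - 1) / real (r - 1) = \<beta>" "(real r - real r0) / (real r - 1) = 1 - \<beta>"
    using r0 by (auto simp: \<beta>_def of_nat_diff field_simps)
  have "(1 - \<beta>) * ln (s {j0}) + \<beta> * ln (s {..<r}) \<le> real (r0 - 1) * \<epsilon> + ln (s ({j0} \<union> B))"
    using B(3) unfolding \<beta>(1) by (simp add: algebra_simps)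
  also have "\<dots> = ln (c ^ (r0 - 1) * s ({j0} \<union> B))"
    using c spos by (simp add: ln_mult_pos ln_realpow \<epsilon>_def)
  also have "(1 - \<beta>) * ln (s {j0}) + \<beta> * ln (s {..<r}) = ln (s {j0} powr (1 - \<beta>) * s {..<r} powr \<beta>)"
    using spos[of "{j0}"] spos[of "{..<r}"] by (simp add: ln_mult_pos ln_powr)
  finally have "s {j0} powr (1 - \<beta>) * s {..<r} powr \<beta> \<le> c ^ (r0 - 1) * s ({j0} \<union> B)"
    using spos[of "{j0}"] spos[of "{..<r}"] spos[of "{j0} \<union> B"] c
    by (subst (asm) ln_le_cancel_iff) auto
  moreover have "card ({j0} \<union> B) = r0"
    using B finite_subset[OF B(1)] r0 by (subst card_Un_disjoint) auto
  ultimately show thesis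
    using that[of "{j0} \<union> B"] B(1) j0 \<beta> unfolding s_def[symmetric] c_def[symmetric] sU \<beta>_def[symmetric] by auto
qed

section \<open>Extensions that avoid a small set\<close>

text \<open>An edge whose vertex of colour \<open>j\<close> lies in \<open>W\<close> is determined by this vertex and its other \<open>r - 1\<close> vertices.
So among the at least \<open>K\<close> edges with the same other vertices at most \<open>card W\<close> are bad.\<close>

lemma few_fibres_meet:
  assumes fin: "finite X" "finite W" and rainbow: "\<And>e. e \<in> X \<Longrightarrow> bij_betw \<chi> e {..<r}"
    and K: "\<And>e. e \<in> X \<Longrightarrow>
      K \<le> card {e' \<in> X. proj \<chi> ({..<r} - {j}) e' = proj \<chi> ({..<r} - {j}) e}"
  shows "K * card {e \<in> X. \<exists>x\<in>e \<inter> W. \<chi> x = j} \<le> card W * card X"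
proof -
  define p where "p = proj \<chi> ({..<r} - {j})"
  define Y where "Y = {e \<in> X. \<exists>x\<in>e \<inter> W. \<chi> x = j}"
  have Y: "finite Y" "Y \<subseteq> X" using fin by (auto simp: Y_def)
  have fib: "card {e \<in> Y. p e = T} \<le> card W" for T
  proof -
    have "{e \<in> Y. p e = T} \<subseteq> (\<lambda>x. insert x T) ` W"
    proof
      fix e assume "e \<in> {e \<in> Y. p e = T}"
      then obtain x where x: "e \<in> X" "p e = T" "x \<in> e" "x \<in> W" "\<chi> x = j"
        by (auto simp: Y_def)
      have "y = x" if "y \<in> e" "\<chi> y = j" for y
        using rainbow[OF x(1)] x that by (auto simp: bij_betw_def inj_on_def)
      moreover have "\<chi> y < r" if "y \<in> e" for y
        using rainbow[OF x(1)] that by (auto simp: bij_betw_def)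
      ultimately have "e = insert x T"
        unfolding x(2)[symmetric] p_def proj_def using x(3,5) by blast
      then show "e \<in> (\<lambda>x. insert x T) ` W" using x by auto
    qed
    then show ?thesis using surj_card_le[OF fin(2)] by blast
  qed
  have "K * card Y = (\<Sum>T\<in>p ` Y. K * card {e \<in> Y. p e = T})"
    by (subst card_eq_sum_fibres[OF Y(1), of p]) (simp add: sum_distrib_left)
  also have "\<dots> \<le> (\<Sum>T\<in>p ` Y. card {e \<in> X. p e = T} * card W)"
  proof (rule sum_mono)
    fix T assume "T \<in> p ` Y"
    then obtain e where "e \<in> X" "T = p e" using Y by auto
    then show "K * card {e \<in> Y. p e = T} \<le> card {e \<in> X. p e = T} * card W"
      using K fib by (intro mult_mono) (auto simp: p_def)
  qed
  also have "\<dots> \<le> (\<Sum>T\<in>p ` X. card {e \<in> X. p e = T} * card W)"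
    using fin Y by (intro sum_mono2) auto
  also have "\<dots> = card X * card W"
    by (subst card_eq_sum_fibres[OF fin(1), of p]) (simp add: sum_distrib_right)
  finally show ?thesis by (simp add: Y_def mult.commute)
qed

text \<open>Summing the proportion \<open>card W / K\<close> of bad edges over the colours outside \<open>I\<close> leaves at least half of the edges.
The extensions of \<open>S\<close> inherit the codegree condition from \<open>A\<close>, since changing a vertex of colour outside \<open>I\<close>
does not affect the projection to \<open>I\<close>.\<close>

lemma many_extensions_avoid:
  assumes fin: "finite A" "finite W" and rainbow: "\<And>e. e \<in> A \<Longrightarrow> bij_betw \<chi> e {..<r}"
    and I: "I \<subseteq> {..<r}" and K: "\<And>j e. j \<in> {..<r} - I \<Longrightarrow> e \<in> A \<Longrightarrow>
      K \<le> card {e' \<in> A. proj \<chi> ({..<r} - {j}) e' = proj \<chi> ({..<r} - {j}) e}"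
    and W: "2 * r * card W \<le> K" "0 < K"
  shows "card {e \<in> A. proj \<chi> I e = S} \<le> 2 * card {e \<in> A. proj \<chi> I e = S \<and> (e - S) \<inter> W = {}}"
proof -
  define X where "X = {e \<in> A. proj \<chi> I e = S}"
  define Y where "Y j = {e \<in> X. \<exists>x\<in>e \<inter> W. \<chi> x = j}" for j
  define Z where "Z = {e \<in> X. (e - S) \<inter> W = {}}"
  have X: "finite X" using fin by (simp add: X_def)
  have Y: "K * card (Y j) \<le> card W * card X" if j: "j \<in> {..<r} - I" for j
    unfolding Y_def
  proof (rule few_fibres_meet[where r = r])
    show "finite X" "finite W" using X fin by auto
    show "bij_betw \<chi> e {..<r}" if "e \<in> X" for e using that rainbow by (simp add: X_def)
    show "K \<le> card {e' \<in> X. proj \<chi> ({..<r} - {j}) e' = proj \<chi> ({..<r} - {j}) e}" if e: "e \<in> X" for e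
    proof -
      have "{e' \<in> A. proj \<chi> ({..<r} - {j}) e' = proj \<chi> ({..<r} - {j}) e} \<subseteq> X"
      proof safe
        fix e' assume e': "e' \<in> A" and eq: "proj \<chi> ({..<r} - {j}) e' = proj \<chi> ({..<r} - {j}) e"
        have "I \<inter> ({..<r} - {j}) = I" using I j by auto
        then have "proj \<chi> I e' = proj \<chi> I e"
          using arg_cong[OF eq, of "proj \<chi> I"] by (simp add: proj_proj)
        then show "e' \<in> X" using e e' by (simp add: X_def)
      qed
      then have "{e' \<in> A. proj \<chi> ({..<r} - {j}) e' = proj \<chi> ({..<r} - {j}) e}
        = {e' \<in> X. proj \<chi> ({..<r} - {j}) e' = proj \<chi> ({..<r} - {j}) e}"
        by (auto simp: X_def)
      then show ?thesis using K[OF j, of e] e by (simp add: X_def)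
    qed
  qed
  have "X \<subseteq> Z \<union> (\<Union>j\<in>{..<r} - I. Y j)"
  proof
    fix e assume e: "e \<in> X"
    then have b: "bij_betw \<chi> e {..<r}" using rainbow by (simp add: X_def)
    show "e \<in> Z \<union> (\<Union>j\<in>{..<r} - I. Y j)"
    proof (cases "e \<in> Z")
      case False
      then obtain x where x: "x \<in> e" "x \<notin> S" "x \<in> W" using e by (auto simp: Z_def)
      then have "\<chi> x \<in> {..<r} - I"
        using e b by (auto simp: X_def proj_def bij_betw_def)
      then show ?thesis using e x by (auto simp: Y_def)
    qed simp
  qed
  then have "card X \<le> card (Z \<union> (\<Union>j\<in>{..<r} - I. Y j))"
    using X by (intro card_mono) (auto simp: Z_def Y_def)
  also have "\<dots> \<le> card Z + (\<Sum>j\<in>{..<r} - I. card (Y j))"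
    by (intro order_trans[OF card_Un_le] add_left_mono card_UN_le) auto
  finally have "K * card X \<le> K * card Z + (\<Sum>j\<in>{..<r} - I. K * card (Y j))"
    by (metis add_mult_distrib2 mult_le_mono2 sum_distrib_left)
  also have "\<dots> \<le> K * card Z + (\<Sum>j\<in>{..<r} - I. card W * card X)"
    using Y by (intro add_left_mono sum_mono) auto
  also have "\<dots> \<le> K * card Z + r * (card W * card X)"
    using card_mono[of "{..<r}" "{..<r} - I"] by (simp add: mult_right_mono)
  finally have "2 * (K * card X) \<le> 2 * (K * card Z) + (2 * r * card W) * card X" by simp
  also have "\<dots> \<le> 2 * (K * card Z) + K * card X"
    using W by (intro add_left_mono mult_right_mono) auto
  finally have "K * card X \<le> K * (2 * card Z)" by simp
  then show ?thesis using W by (simp add: X_def Z_def conj_assoc)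
qed

text \<open>Ways to extend all sets in \<open>X\<close>, each \<open>S\<close> to a member of \<open>E S\<close>, such that the added parts are pairwise
disjoint and disjoint from \<open>W\<close>. With \<open>X\<close> the edge set of a copy of \<open>F\<close> and \<open>W\<close> its vertex set, these are
the copies of the expansion of \<open>F\<close> on top of that copy. The set \<open>W\<close> is not just \<open>\<Union>X\<close>, because \<open>F\<close> may
have isolated vertices.\<close>

definition disjoint_choices :: "'b set set \<Rightarrow> ('b set \<Rightarrow> 'b set set) \<Rightarrow> 'b set \<Rightarrow> ('b set \<Rightarrow> 'b set) set" where
  "disjoint_choices X E W = {\<phi> \<in> PiE X E. (\<forall>S\<in>X. (\<phi> S - S) \<inter> W = {}) \<and>
     (\<forall>S\<in>X. \<forall>T\<in>X. S \<noteq> T \<longrightarrow> (\<phi> S - S) \<inter> (\<phi> T - T) = {})}"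

lemma disjoint_choicesI:
  assumes "\<phi> \<in> PiE X E" "\<And>S. S \<in> X \<Longrightarrow> (\<phi> S - S) \<inter> W = {}"
    "\<And>S T. S \<in> X \<Longrightarrow> T \<in> X \<Longrightarrow> S \<noteq> T \<Longrightarrow> (\<phi> S - S) \<inter> (\<phi> T - T) = {}"
  shows "\<phi> \<in> disjoint_choices X E W"
  using assms by (simp add: disjoint_choices_def)

lemma finite_disjoint_choices:
  assumes "finite X" "\<And>S. finite (E S)"
  shows "finite (disjoint_choices X E W)"
  unfolding disjoint_choices_def
  by (rule finite_subset[of _ "PiE X E"]) (use assms in \<open>auto intro: finite_PiE\<close>)

text \<open>The sets are extended one by one; each new choice avoids \<open>W\<close> and the at most \<open>a\<close> vertices added by each
earlier choice.\<close>

lemma many_disjoint_choices: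
  fixes t :: real and X :: "'b set set"
  assumes "finite X" "\<And>S. finite (E S)" "t \<ge> 0" "finite W"
    and size: "\<And>S e. S \<in> X \<Longrightarrow> e \<in> E S \<Longrightarrow> finite e \<and> card (e - S) \<le> a"
    and many: "\<And>S W'. S \<in> X \<Longrightarrow> finite W' \<Longrightarrow> card W' \<le> card W + a * card X \<Longrightarrow>
      t \<le> real (card {e \<in> E S. (e - S) \<inter> W' = {}})"
  shows "t ^ card X \<le> real (card (disjoint_choices X E W))"
  using assms(1) size many
proof (induction X rule: finite_induct)
  case empty
  show ?case by (simp add: disjoint_choices_def)
next
  case (insert S X)
  define D where "D = disjoint_choices X E W"
  have finD: "finite D" "finite (disjoint_choices (insert S X) E W)"
    unfolding D_def using insert.hyps(1) assms(2) by (auto intro!: finite_disjoint_choices)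
  define W' where "W' \<phi> = W \<union> (\<Union>T\<in>X. \<phi> T - T)" for \<phi> :: "'b set \<Rightarrow> 'b set"
  define N where "N \<phi> = {e \<in> E S. (e - S) \<inter> W' \<phi> = {}}" for \<phi>
  have IH: "t ^ card X \<le> real (card D)"
    unfolding D_def
  proof (rule insert.IH)
    show "finite e \<and> card (e - T) \<le> a" if "T \<in> X" "e \<in> E T" for T e
      using insert.prems(1)[of T e] that by simp
    show "t \<le> real (card {e \<in> E T. (e - T) \<inter> W' = {}})"
      if "T \<in> X" "finite W'" "card W' \<le> card W + a * card X" for T W'
      using insert.prems(2)[of T W'] that insert.hyps by simp
  qed
  have N: "t \<le> real (card (N \<phi>))" if "\<phi> \<in> D" for \<phi>
    unfolding N_def
  proof (rule insert.prems(2))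
    have \<phi>: "finite (\<phi> T) \<and> card (\<phi> T - T) \<le> a" if "T \<in> X" for T
      using \<open>\<phi> \<in> D\<close> that insert.prems(1)[of T "\<phi> T"] by (auto simp: D_def disjoint_choices_def)
    then show "finite (W' \<phi>)" using insert.hyps(1) assms(4) by (simp add: W'_def)
    have "card (W' \<phi>) \<le> card W + card (\<Union>T\<in>X. \<phi> T - T)"
      unfolding W'_def by (rule card_Un_le)
    also have "card (\<Union>T\<in>X. \<phi> T - T) \<le> (\<Sum>T\<in>X. card (\<phi> T - T))"
      using insert.hyps(1) by (rule card_UN_le)
    also have "\<dots> \<le> a * card (insert S X)"
      using sum_bounded_above[of X "\<lambda>T. card (\<phi> T - T)" a] \<phi> insert.hyps by (simp add: mult.commute)
    finally show "card (W' \<phi>) \<le> card W + a * card (insert S X)" by simp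
  qed simp
  define g where "g = (\<lambda>(\<phi>, e). \<phi>(S := e :: 'b set))"
  have "inj_on g (Sigma D N)"
  proof (rule inj_onI)
    fix x y assume h: "x \<in> Sigma D N" "y \<in> Sigma D N" "g x = g y"
    obtain \<phi> e \<psi> e' where xy: "x = (\<phi>, e)" "y = (\<psi>, e')" by fastforce
    have eq: "\<phi>(S := e) = \<psi>(S := e')" using h xy by (simp add: g_def)
    have "\<phi> \<in> PiE X E" "\<psi> \<in> PiE X E" using h xy by (auto simp: D_def disjoint_choices_def)
    then have "\<phi> S = undefined" "\<psi> S = undefined" using insert.hyps(2) by auto
    then have "\<phi> T = \<psi> T" for T using fun_cong[OF eq, of T] by (cases "T = S") auto
    then show "x = y" using fun_cong[OF eq, of S] by (auto simp: xy)
  qed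
  moreover have "g ` Sigma D N \<subseteq> disjoint_choices (insert S X) E W"
  proof safe
    fix \<phi> e assume "\<phi> \<in> D" "e \<in> N \<phi>"
    then have "\<phi> \<in> PiE X E" "\<forall>T\<in>X. (\<phi> T - T) \<inter> W = {}"
      "\<forall>T\<in>X. \<forall>T'\<in>X. T \<noteq> T' \<longrightarrow> (\<phi> T - T) \<inter> (\<phi> T' - T') = {}"
      "e \<in> E S" "(e - S) \<inter> W = {}" "\<forall>T\<in>X. (e - S) \<inter> (\<phi> T - T) = {}"
      by (auto simp: D_def N_def W'_def disjoint_choices_def)
    note h = this
    have 1: "\<phi>(S := e) \<in> PiE (insert S X) E" using h by (intro PiE_fun_upd) auto
    have 2: "((\<phi>(S := e)) T - T) \<inter> W = {}" if "T \<in> insert S X" for T using that h by auto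
    have 3: "((\<phi>(S := e)) T - T) \<inter> ((\<phi>(S := e)) T' - T') = {}"
      if "T \<in> insert S X" "T' \<in> insert S X" "T \<noteq> T'" for T T'
      using that h insert.hyps(2) by (cases "T = S"; cases "T' = S") (auto simp: Int_commute)
    show "g (\<phi>, e) \<in> disjoint_choices (insert S X) E W"
      unfolding g_def prod.case using 1 2 3 by (rule disjoint_choicesI)
  qed
  ultimately have "card (Sigma D N) \<le> card (disjoint_choices (insert S X) E W)"
    using finD by (intro card_inj_on_le[of g])
  moreover have "card (Sigma D N) = (\<Sum>\<phi>\<in>D. card (N \<phi>))"
    using finD assms(2) by (subst card_SigmaI) (auto simp: N_def)
  ultimately have "(\<Sum>\<phi>\<in>D. real (card (N \<phi>))) \<le> real (card (disjoint_choices (insert S X) E W))"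
    by (metis of_nat_le_iff of_nat_sum)
  moreover have "real (card D) * t \<le> (\<Sum>\<phi>\<in>D. real (card (N \<phi>)))"
    using N by (rule sum_bounded_below)
  moreover have "t ^ card X * t \<le> real (card D) * t"
    using IH assms(3) by (rule mult_right_mono)
  ultimately show ?case using insert.hyps by (simp add: mult.commute)
qed


section \<open>Lifting copies to copies of the expansion\<close>

lemma edges_expansion:
  "edges (expansion r0 r F) = (\<lambda>e. Inl ` e \<union> Inr ` ({e} \<times> {..<r - r0})) ` edges F"
  and verts_expansion: "verts (expansion r0 r F) = Inl ` verts F \<union> Inr ` (edges F \<times> {..<r - r0})"
  by (auto simp: expansion_def)

lemma card_edges_expansion:
  assumes "r0 < r"
  shows "card (edges (expansion r0 r F)) = card (edges F)"
  unfolding edges_expansion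
proof (rule card_image, rule inj_onI)
  fix e e' :: "'a set"
  assume eq: "Inl ` e \<union> Inr ` ({e} \<times> {..<r - r0}) = Inl ` e' \<union> Inr ` ({e'} \<times> {..<r - r0})"
  have "Inr (e, 0) \<in> Inl ` e \<union> Inr ` ({e} \<times> {..<r - r0})" using assms by auto
  then show "e = e'" unfolding eq by auto
qed

lemma expansion_copy:
  assumes F: "rgraph r0 F" and f: "inj_on f (verts F)" "f ` verts F \<subseteq> verts H"
    and \<phi>: "\<phi> \<in> disjoint_choices ((\<lambda>e. f ` e) ` edges F) E (f ` verts F)"
    and E: "\<And>S e. e \<in> E S \<Longrightarrow> e \<in> edges H \<and> S \<subseteq> e"
    and H: "rgraph r H" and r: "r0 \<le> r" "0 < r0"
  shows "\<phi> ` (\<lambda>e. f ` e) ` edges F \<in> copies (expansion r0 r F) H"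
proof -
  have Hv: "e \<subseteq> verts H" "card e = r" "finite e" if "e \<in> edges H" for e
    using H that by (auto simp: rgraph_def intro: finite_subset)
  have Fv: "e \<subseteq> verts F" "card e = r0" if "e \<in> edges F" for e
    using F that by (auto simp: rgraph_def)
  have \<phi>E: "\<phi> (f ` e) \<in> edges H" "f ` e \<subseteq> \<phi> (f ` e)" if "e \<in> edges F" for e
    using \<phi> that E by (auto simp: disjoint_choices_def)
  define new where "new e = \<phi> (f ` e) - f ` e" for e
  have "card (new e) = r - r0" "finite (new e)" if e: "e \<in> edges F" for e
  proof -
    have "card (f ` e) = r0" using Fv[OF e] f(1) by (metis card_image inj_on_subset)
    then show "card (new e) = r - r0" "finite (new e)"
      using Hv[OF \<phi>E(1)[OF e]] \<phi>E(2)[OF e] by (auto simp: new_def card_Diff_subset finite_subset)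
  qed
  then have "\<forall>e\<in>edges F. \<exists>h. bij_betw h {..<r - r0} (new e)"
    by (metis ex_bij_betw_nat_finite atLeast0LessThan)
  then obtain h where h: "\<And>e. e \<in> edges F \<Longrightarrow> bij_betw (h e) {..<r - r0} (new e)"
    by metis
  define g where "g = case_sum f (\<lambda>(e, j). h e j)"
  have new_old: "new e \<inter> f ` verts F = {}" if "e \<in> edges F" for e
    using \<phi> that by (auto simp: disjoint_choices_def new_def)
  have new_new: "new e \<inter> new e' = {}" if "e \<in> edges F" "e' \<in> edges F" "e \<noteq> e'" for e e'
  proof -
    have "f ` e \<noteq> f ` e'"
      using inj_on_image_eq_iff[OF f(1) Fv(1)[OF that(1)] Fv(1)[OF that(2)]] that(3) by simp
    then show ?thesis using \<phi> that by (auto simp: disjoint_choices_def new_def)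
  qed
  have hin: "h e j \<in> new e" if "e \<in> edges F" "j < r - r0" for e j
    using h[OF that(1)] that(2) by (auto simp: bij_betw_def)
  have "inj_on g (verts (expansion r0 r F))"
  proof (rule inj_onI)
    fix x y assume x: "x \<in> verts (expansion r0 r F)" and y: "y \<in> verts (expansion r0 r F)"
      and eq: "g x = g y"
    consider a b where "x = Inl a" "y = Inl b" "a \<in> verts F" "b \<in> verts F"
      | a e j where "x = Inl a" "y = Inr (e, j)" "a \<in> verts F" "e \<in> edges F" "j < r - r0"
      | a e j where "y = Inl a" "x = Inr (e, j)" "a \<in> verts F" "e \<in> edges F" "j < r - r0"
      | e j e' j' where "x = Inr (e, j)" "y = Inr (e', j')" "e \<in> edges F" "j < r - r0"
          "e' \<in> edges F" "j' < r - r0"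
      using x y unfolding verts_expansion by blast
    then show "x = y"
    proof cases
      case 1
      then show ?thesis using eq f(1) by (auto simp: g_def inj_on_def)
    next
      case 2
      then have "f a \<in> new e" using eq hin[of e j] by (simp add: g_def)
      then show ?thesis using 2 new_old[of e] by blast
    next
      case 3
      then have "f a \<in> new e" using eq hin[of e j] by (simp add: g_def)
      then show ?thesis using 3 new_old[of e] by blast
    next
      case 4
      then have "e = e'" using eq hin[of e j] hin[of e' j'] new_new[of e e'] by (auto simp: g_def)
      then show ?thesis using 4 eq h[of e] by (auto simp: g_def bij_betw_def inj_on_def)
    qed
  qed
  moreover have edge: "g ` (Inl ` e \<union> Inr ` ({e} \<times> {..<r - r0})) = \<phi> (f ` e)" if e: "e \<in> edges F" for e
  proof -
    have "g ` (Inl ` e \<union> Inr ` ({e} \<times> {..<r - r0})) = f ` e \<union> h e ` {..<r - r0}"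
      by (force simp: g_def image_Un image_image)
    also have "\<dots> = \<phi> (f ` e)"
      using h[OF e] \<phi>E(2)[OF e] by (auto simp: bij_betw_def new_def)
    finally show ?thesis .
  qed
  moreover have "g ` verts (expansion r0 r F) \<subseteq> verts H"
  proof -
    have "h e j \<in> verts H" if "e \<in> edges F" "j < r - r0" for e j
      using hin[OF that] \<phi>E(1)[OF that(1)] Hv by (auto simp: new_def)
    then show ?thesis using f(2) by (auto simp: verts_expansion g_def)
  qed
  moreover have "\<forall>e\<in>edges (expansion r0 r F). g ` e \<in> edges H"
    using edge \<phi>E(1) by (auto simp: edges_expansion)
  moreover have "\<phi> ` (\<lambda>e. f ` e) ` edges F = (\<lambda>e. g ` e) ` edges (expansion r0 r F)"
    using edge unfolding edges_expansion image_image by (intro image_cong) auto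
  ultimately show ?thesis unfolding copies_def by blast
qed

lemma max_deg_le:
  assumes fin: "finite (verts H)" and i: "i \<le> card (verts H)"
    and le: "\<And>S. S \<subseteq> verts H \<Longrightarrow> card S = i \<Longrightarrow> real (deg H S) \<le> b"
  shows "real (max_deg i H) \<le> b"
proof -
  let ?\<S> = "{S. S \<subseteq> verts H \<and> card S = i}"
  have "finite ?\<S>" by (rule finite_subset[of _ "Pow (verts H)"]) (use fin in auto)
  moreover have "?\<S> \<noteq> {}" using obtain_subset_with_card_n[OF i] by blast
  ultimately have "Max (deg H ` ?\<S>) \<in> deg H ` ?\<S>" by (intro Max_in) auto
  then show ?thesis using le unfolding max_deg_def by auto
qed

lemma deg_le_max_deg:
  assumes "finite (verts H)" "S \<subseteq> verts H" "card S = i"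
  shows "deg H S \<le> max_deg i H"
proof -
  have "finite {S. S \<subseteq> verts H \<and> card S = i}"
    by (rule finite_subset[of _ "Pow (verts H)"]) (use assms in auto)
  then show ?thesis using assms(2,3) unfolding max_deg_def by (intro Max_ge) auto
qed

lemma finite_edges: "rgraph r H \<Longrightarrow> finite (edges H)"
  by (auto simp: rgraph_def intro: finite_subset[of _ "Pow (verts H)"])

lemma card_copy:
  assumes "rgraph r F" "C \<in> copies F H"
  shows "card C = card (edges F)"
proof -
  obtain f where f: "inj_on f (verts F)" "C = (\<lambda>e. f ` e) ` edges F"
    using assms(2) by (auto simp: copies_def)
  have "inj_on (\<lambda>e. f ` e) (edges F)"
  proof (rule inj_onI)
    fix e e' assume "e \<in> edges F" "e' \<in> edges F" "f ` e = f ` e'"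
    moreover from this have "e \<subseteq> verts F" "e' \<subseteq> verts F" using assms(1) by (auto simp: rgraph_def)
    ultimately show "e = e'" using inj_on_image_eq_iff[OF f(1)] by blast
  qed
  then show ?thesis by (simp add: f(2) card_image)
qed

text \<open>The copies in \<open>\<D>\<close> are all disjoint extensions of the copies in \<open>\<C>\<close>. Projecting to \<open>I\<close> recovers from a lifted
copy first the copy it came from and then the choice of extensions, which gives the lower bound on
\<open>card \<D>\<close>. Conversely, \<open>i\<close> edges of a lifted copy project to \<open>i\<close> distinct edges of the underlying copy, so that
there are at most \<open>max_deg i\<close> choices for the latter, and then only \<open>k - i\<close> extensions remain free. The
codegree bound exceeds \<open>2 * r\<close> times the number of vertices to be avoided: those of the copy, and
at most \<open>r\<close> for each of its extended edges.\<close>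

lemma lift_copies:
  fixes F :: "'a hypergraph" and H :: "'b hypergraph" and A :: "'b set set" and d D :: real
  assumes F: "rgraph r0 F" and H: "rgraph r H" and r: "0 < r0" "r0 < r"
    and A: "A \<subseteq> edges H" and I: "I \<subseteq> {..<r}" "card I = r0"
    and rainbow: "\<And>e. e \<in> A \<Longrightarrow> bij_betw \<chi> e {..<r}"
    and U: "U \<subseteq> verts H" and \<C>: "\<C> \<subseteq> copies F \<lparr>verts = U, edges = proj \<chi> I ` A\<rparr>" "\<C> \<noteq> {}"
    and D: "0 < d" "\<And>e. e \<in> A \<Longrightarrow> d \<le> real (card {e' \<in> A. proj \<chi> I e' = proj \<chi> I e})"
      "\<And>e. e \<in> A \<Longrightarrow> real (card {e' \<in> A. proj \<chi> I e' = proj \<chi> I e}) \<le> D"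
    and K: "\<And>j e. j \<in> {..<r} - I \<Longrightarrow> e \<in> A \<Longrightarrow>
      2 * r * (card (verts F) + r * card (edges F)) < card {e' \<in> A. proj \<chi> ({..<r} - {j}) e' = proj \<chi> ({..<r} - {j}) e}"
  obtains \<D> where "\<D> \<noteq> {}" "\<D> \<subseteq> copies (expansion r0 r F) H"
    "real (card \<C>) * (d / 2) ^ card (edges F) \<le> real (card \<D>)"
    "\<And>i. i \<in> {1..card (edges F)} \<Longrightarrow> real (max_deg i \<lparr>verts = edges H, edges = \<D>\<rparr>)
      \<le> real (max_deg i \<lparr>verts = proj \<chi> I ` A, edges = \<C>\<rparr>) * D ^ (card (edges F) - i)"
proof -
  define \<pi> where "\<pi> = proj \<chi> I"
  define G where "G = \<pi> ` A"
  define E where "E S = {e \<in> A. \<pi> e = S}" for S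
  define k where "k = card (edges F)"
  have finA: "finite A" using A finite_edges[OF H] by (rule finite_subset)
  have finG: "finite G" using finA by (simp add: G_def)
  have finE: "finite (E S)" for S using finA by (simp add: E_def)
  have \<pi>sub: "\<pi> e \<subseteq> e" for e by (auto simp: \<pi>_def proj_def)
  have Acard: "finite e" "card e = r" if "e \<in> A" for e
    using H A that by (auto simp: rgraph_def intro: finite_subset)
  have "\<forall>C\<in>\<C>. \<exists>f. inj_on f (verts F) \<and> f ` verts F \<subseteq> U \<and>
      (\<forall>e\<in>edges F. f ` e \<in> G) \<and> C = (\<lambda>e. f ` e) ` edges F"
    using \<C>(1) unfolding copies_def G_def \<pi>_def by auto
  then obtain f where f: "\<And>C. C \<in> \<C> \<Longrightarrow> inj_on (f C) (verts F)"
    "\<And>C. C \<in> \<C> \<Longrightarrow> f C ` verts F \<subseteq> U"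
    "\<And>C e. C \<in> \<C> \<Longrightarrow> e \<in> edges F \<Longrightarrow> f C ` e \<in> G"
    "\<And>C. C \<in> \<C> \<Longrightarrow> (\<lambda>e. f C ` e) ` edges F = C"
    by metis
  have Ck: "card C = k" "finite C" "C \<subseteq> G" if "C \<in> \<C>" for C
  proof -
    show "card C = k" unfolding k_def using \<C>(1) that by (intro card_copy[OF F]) auto
    show "finite C" using f(4)[OF that] finite_edges[OF F] by (metis finite_imageI)
    have "(\<lambda>e. f C ` e) ` edges F \<subseteq> G" using f(3)[OF that] by blast
    then show "C \<subseteq> G" unfolding f(4)[OF that] .
  qed
  define \<Phi> where "\<Phi> C = disjoint_choices C E (f C ` verts F)" for C
  have fin\<Phi>: "finite (\<Phi> C)" if "C \<in> \<C>" for C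
    unfolding \<Phi>_def using Ck(2)[OF that] finE by (rule finite_disjoint_choices)
  have \<Phi>E: "\<phi> S \<in> A" "\<pi> (\<phi> S) = S" if "\<phi> \<in> \<Phi> C" "S \<in> C" for \<phi> S C
  proof -
    have "\<phi> S \<in> E S" using that by (auto simp: \<Phi>_def disjoint_choices_def)
    then show "\<phi> S \<in> A" "\<pi> (\<phi> S) = S" by (simp_all add: E_def)
  qed
  have \<pi>\<Phi>: "\<pi> ` \<phi> ` C = C" if "\<phi> \<in> \<Phi> C" for \<phi> C
    using \<Phi>E(2)[OF that] by (auto simp: image_image)
  have \<Phi>ge: "(d / 2) ^ k \<le> real (card (\<Phi> C))" if C: "C \<in> \<C>" for C
  proof -
    have finF: "finite (verts F)" using F by (simp add: rgraph_def)
    have cW: "card (f C ` verts F) + r * card C \<le> card (verts F) + r * card (edges F)"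
      using Ck(1)[OF C] card_image_le[OF finF] by (simp add: k_def)
    have "(d / 2) ^ card C \<le> real (card (disjoint_choices C E (f C ` verts F)))"
    proof (rule many_disjoint_choices[where a = r])
      show "finite C" "finite (E S)" "0 \<le> d / 2" "finite (f C ` verts F)" for S
        using Ck(2)[OF C] finE D(1) finF by auto
      show "finite e \<and> card (e - S) \<le> r" if "S \<in> C" "e \<in> E S" for S e
        using Acard[of e] that card_mono[of e "e - S"] by (auto simp: E_def)
      show "d / 2 \<le> real (card {e \<in> E S. (e - S) \<inter> W = {}})"
        if S: "S \<in> C" and W: "finite W" "card W \<le> card (f C ` verts F) + r * card C" for S W
      proof -
        obtain e where e: "e \<in> A" "S = \<pi> e" using S Ck(3)[OF C] by (auto simp: G_def)
        have "card W \<le> card (verts F) + r * card (edges F)" using W(2) cW by linarith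
        then have W2: "2 * r * card W \<le> 2 * r * (card (verts F) + r * card (edges F)) + 1"
          using mult_le_mono2 trans_le_add1 by blast
        have "card {e \<in> A. proj \<chi> I e = S} \<le> 2 * card {e \<in> A. proj \<chi> I e = S \<and> (e - S) \<inter> W = {}}"
          by (rule many_extensions_avoid[OF finA W(1) rainbow I(1) _ W2]) (use K in \<open>auto simp: Suc_le_eq\<close>)
        moreover have "d \<le> real (card {e \<in> A. proj \<chi> I e = S})"
          using D(2)[OF e(1)] e(2) by (simp add: \<pi>_def)
        moreover have "{e \<in> E S. (e - S) \<inter> W = {}} = {e \<in> A. proj \<chi> I e = S \<and> (e - S) \<inter> W = {}}"
          by (auto simp: E_def \<pi>_def)
        ultimately show ?thesis by simp
      qed
    qed
    then show ?thesis using Ck(1)[OF C] by (simp add: \<Phi>_def)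
  qed
  define L where "L C = (\<lambda>\<phi>. \<phi> ` C) ` \<Phi> C" for C
  have \<pi>L: "\<pi> ` X = C" if X: "X \<in> L C" for X C
  proof -
    obtain \<phi> where "\<phi> \<in> \<Phi> C" "X = \<phi> ` C" using X unfolding L_def by blast
    then show ?thesis by (simp only: \<pi>\<Phi>)
  qed
  have cardL: "card (L C) = card (\<Phi> C)" for C
    unfolding L_def
  proof (rule card_image, rule inj_onI)
    fix \<phi> \<psi> assume h: "\<phi> \<in> \<Phi> C" "\<psi> \<in> \<Phi> C" "\<phi> ` C = \<psi> ` C"
    have "\<phi> S = \<psi> S" if S: "S \<in> C" for S
    proof -
      obtain T where T: "T \<in> C" "\<phi> S = \<psi> T" using h(3) S by (metis image_iff)
      then have "S = T" using \<Phi>E(2)[OF h(1) S] \<Phi>E(2)[OF h(2) T(1)] by simp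
      then show ?thesis using T by simp
    qed
    moreover have "\<phi> \<in> PiE C E" "\<psi> \<in> PiE C E" using h by (auto simp: \<Phi>_def disjoint_choices_def)
    ultimately show "\<phi> = \<psi>" by (intro PiE_ext[of \<phi> C E \<psi>]) auto
  qed
  define \<D> where "\<D> = (\<Union>C\<in>\<C>. L C)"
  have fin\<C>: "finite \<C>" using Ck(3) finG by (auto intro: finite_subset[of _ "Pow G"])
  have card\<D>: "card \<D> = (\<Sum>C\<in>\<C>. card (\<Phi> C))"
  proof -
    have "L C \<inter> L C' = {}" if "C \<noteq> C'" for C C' using \<pi>L that by blast
    moreover have "finite (L C)" if "C \<in> \<C>" for C using fin\<Phi>[OF that] by (simp add: L_def)
    ultimately show ?thesis
      unfolding \<D>_def using fin\<C> by (subst card_UN_disjoint) (simp_all add: cardL)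
  qed
  have lower: "real (card \<C>) * (d / 2) ^ k \<le> real (card \<D>)"
    unfolding card\<D> of_nat_sum using \<Phi>ge by (rule sum_bounded_below)
  moreover have "\<D> \<noteq> {}"
  proof
    assume "\<D> = {}"
    then have "real (card \<C>) * (d / 2) ^ k \<le> 0" using lower by simp
    moreover have "0 < real (card \<C>) * (d / 2) ^ k"
      using D(1) fin\<C> \<C>(2) by (simp add: card_gt_0_iff)
    ultimately show False by simp
  qed
  moreover have "\<D> \<subseteq> copies (expansion r0 r F) H"
  proof
    fix X assume "X \<in> \<D>"
    then obtain C \<phi> where C: "C \<in> \<C>" and \<phi>: "\<phi> \<in> \<Phi> C" "X = \<phi> ` C" by (auto simp: \<D>_def L_def)
    have "\<phi> ` (\<lambda>e. f C ` e) ` edges F \<in> copies (expansion r0 r F) H"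
    proof (rule expansion_copy[OF F f(1)[OF C]])
      show "f C ` verts F \<subseteq> verts H" using f(2)[OF C] U by blast
      show "\<phi> \<in> disjoint_choices ((\<lambda>e. f C ` e) ` edges F) E (f C ` verts F)"
        using \<phi>(1) unfolding f(4)[OF C] \<Phi>_def .
      show "e \<in> edges H \<and> S \<subseteq> e" if "e \<in> E S" for S e
        using that A \<pi>sub[of e] by (auto simp: E_def)
    qed (use H r in auto)
    then show "X \<in> copies (expansion r0 r F) H" unfolding f(4)[OF C] \<phi>(2) .
  qed
  moreover have "real (max_deg i \<lparr>verts = edges H, edges = \<D>\<rparr>)
      \<le> real (max_deg i \<lparr>verts = G, edges = \<C>\<rparr>) * D ^ (k - i)" if i: "i \<in> {1..k}" for i
  proof (rule max_deg_le)
    obtain C where C: "C \<in> \<C>" using \<C>(2) by auto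
    have "C \<noteq> {}" using Ck(1)[OF C] i by auto
    then obtain e0 where e0: "e0 \<in> A" using Ck(3)[OF C] by (auto simp: G_def)
    have D0: "0 \<le> D" using D(3)[OF e0] by (meson of_nat_0_le_iff order_trans)
    show "finite (verts \<lparr>verts = edges H, edges = \<D>\<rparr>)" using finite_edges[OF H] by simp
    have "k \<le> card G" using card_mono[OF finG Ck(3)[OF C]] Ck(1)[OF C] by simp
    also have "\<dots> \<le> card A" unfolding G_def using finA by (rule card_image_le)
    also have "\<dots> \<le> card (edges H)" using card_mono[OF finite_edges[OF H] A] .
    finally show "i \<le> card (verts \<lparr>verts = edges H, edges = \<D>\<rparr>)" using i by simp
    fix \<sigma> assume "\<sigma> \<subseteq> verts \<lparr>verts = edges H, edges = \<D>\<rparr>" and card\<sigma>: "card \<sigma> = i"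
    show "real (deg \<lparr>verts = edges H, edges = \<D>\<rparr> \<sigma>) \<le> real (max_deg i \<lparr>verts = G, edges = \<C>\<rparr>) * D ^ (k - i)"
    proof (cases "{X \<in> \<D>. \<sigma> \<subseteq> X} = {}")
      case True
      then have "deg \<lparr>verts = edges H, edges = \<D>\<rparr> \<sigma> = 0" by (simp only: deg_def hypergraph.simps card.empty)
      then show ?thesis using D0 by simp
    next
      case False
      then obtain C1 \<phi>1 where C1: "C1 \<in> \<C>" "\<phi>1 \<in> \<Phi> C1" "\<sigma> \<subseteq> \<phi>1 ` C1"
        by (auto simp: \<D>_def L_def)
      have inj\<pi>: "inj_on \<pi> \<sigma>"
      proof (rule inj_onI)
        fix x y assume "x \<in> \<sigma>" "y \<in> \<sigma>" and eq: "\<pi> x = \<pi> y"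
        then obtain S T where "S \<in> C1" "T \<in> C1" "x = \<phi>1 S" "y = \<phi>1 T" using C1(3) by blast
        then show "x = y" using eq \<Phi>E(2)[OF C1(2)] by simp
      qed
      have \<pi>\<sigma>: "\<pi> ` \<sigma> \<subseteq> G" "card (\<pi> ` \<sigma>) = i"
        using C1 \<Phi>E(1)[OF C1(2)] card\<sigma> card_image[OF inj\<pi>] by (auto simp: G_def)
      have fin\<sigma>: "finite \<sigma>" using card\<sigma> i by (auto intro: card_ge_0_finite)
      define \<C>' where "\<C>' = {C \<in> \<C>. \<pi> ` \<sigma> \<subseteq> C}"
      define N where "N C = (\<lambda>\<phi>. \<sigma> \<union> \<phi> ` (C - \<pi> ` \<sigma>)) ` PiE (C - \<pi> ` \<sigma>) E" for C
      have sub: "{X \<in> \<D>. \<sigma> \<subseteq> X} \<subseteq> (\<Union>C\<in>\<C>'. N C)"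
      proof
        fix X assume "X \<in> {X \<in> \<D>. \<sigma> \<subseteq> X}"
        then obtain C \<phi> where C: "C \<in> \<C>" and \<phi>: "\<phi> \<in> \<Phi> C" and X: "X = \<phi> ` C" "\<sigma> \<subseteq> X"
          by (auto simp: \<D>_def L_def)
        have \<phi>\<pi>: "\<phi> (\<pi> e) = e" if e: "e \<in> \<sigma>" for e
        proof -
          obtain S where "S \<in> C" "e = \<phi> S" using e X by auto
          then show ?thesis using \<Phi>E(2)[OF \<phi>] by simp
        qed
        have sC: "\<pi> ` \<sigma> \<subseteq> C" using X \<pi>\<Phi>[OF \<phi>] by blast
        have "X = \<phi> ` (\<pi> ` \<sigma>) \<union> \<phi> ` (C - \<pi> ` \<sigma>)" using X(1) sC by auto
        also have "\<phi> ` (\<pi> ` \<sigma>) = \<sigma>" using \<phi>\<pi> by (force simp: image_image)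
        also have "\<phi> ` (C - \<pi> ` \<sigma>) = restrict \<phi> (C - \<pi> ` \<sigma>) ` (C - \<pi> ` \<sigma>)" by auto
        finally have "X = \<sigma> \<union> restrict \<phi> (C - \<pi> ` \<sigma>) ` (C - \<pi> ` \<sigma>)" .
        moreover have "restrict \<phi> (C - \<pi> ` \<sigma>) \<in> PiE (C - \<pi> ` \<sigma>) E"
          using \<phi> by (auto simp: \<Phi>_def disjoint_choices_def)
        ultimately have "X \<in> N C" unfolding N_def by (rule image_eqI)
        moreover have "C \<in> \<C>'" using C sC by (simp add: \<C>'_def)
        ultimately show "X \<in> (\<Union>C\<in>\<C>'. N C)" by blast
      qed
      have N: "real (card (N C)) \<le> D ^ (k - i)" "finite (N C)" if "C \<in> \<C>'" for C
      proof -
        have C: "C \<in> \<C>" "\<pi> ` \<sigma> \<subseteq> C" using that by (auto simp: \<C>'_def)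
        have finP: "finite (PiE (C - \<pi> ` \<sigma>) E)" using Ck(2)[OF C(1)] finE by (intro finite_PiE) auto
        then show "finite (N C)" by (simp add: N_def)
        have "card (N C) \<le> card (PiE (C - \<pi> ` \<sigma>) E)" unfolding N_def using finP by (rule card_image_le)
        also have "\<dots> = (\<Prod>S\<in>C - \<pi> ` \<sigma>. card (E S))"
          using Ck(2)[OF C(1)] by (simp add: card_PiE)
        finally have "real (card (N C)) \<le> (\<Prod>S\<in>C - \<pi> ` \<sigma>. real (card (E S)))"
          by (metis of_nat_le_iff of_nat_prod)
        also have "\<dots> \<le> (\<Prod>S\<in>C - \<pi> ` \<sigma>. D)"
        proof (rule prod_mono)
          fix S assume "S \<in> C - \<pi> ` \<sigma>"
          then obtain e where "e \<in> A" "S = \<pi> e" using Ck(3)[OF C(1)] by (auto simp: G_def)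
          then show "0 \<le> real (card (E S)) \<and> real (card (E S)) \<le> D"
            using D(3) by (simp add: E_def \<pi>_def)
        qed
        also have "\<dots> = D ^ (k - i)"
          using Ck(1,2)[OF C(1)] \<pi>\<sigma>(2) C(2) fin\<sigma> by (simp add: card_Diff_subset)
        finally show "real (card (N C)) \<le> D ^ (k - i)" .
      qed
      have fin\<C>': "finite \<C>'" using fin\<C> by (simp add: \<C>'_def)
      have "deg \<lparr>verts = edges H, edges = \<D>\<rparr> \<sigma> \<le> card (\<Union>C\<in>\<C>'. N C)"
        unfolding deg_def hypergraph.simps using fin\<C>' N(2) by (intro card_mono sub) auto
      also have "\<dots> \<le> (\<Sum>C\<in>\<C>'. card (N C))" using fin\<C>' by (rule card_UN_le)
      finally have "real (deg \<lparr>verts = edges H, edges = \<D>\<rparr> \<sigma>) \<le> (\<Sum>C\<in>\<C>'. real (card (N C)))"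
        by (metis of_nat_le_iff of_nat_sum)
      also have "\<dots> \<le> real (card \<C>') * D ^ (k - i)"
        using N(1) by (intro sum_bounded_above) auto
      also have "\<dots> \<le> real (max_deg i \<lparr>verts = G, edges = \<C>\<rparr>) * D ^ (k - i)"
      proof (intro mult_right_mono of_nat_mono)
        have "card \<C>' = deg \<lparr>verts = G, edges = \<C>\<rparr> (\<pi> ` \<sigma>)" by (simp add: deg_def \<C>'_def)
        also have "\<dots> \<le> max_deg i \<lparr>verts = G, edges = \<C>\<rparr>"
          using finG \<pi>\<sigma> by (intro deg_le_max_deg) auto
        finally show "card \<C>' \<le> max_deg i \<lparr>verts = G, edges = \<C>\<rparr>" .
      qed (use D0 in simp)
      finally show ?thesis .
    qed
  qed
  ultimately show thesis using that[of \<D>] unfolding k_def G_def \<pi>_def by blast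
qed


section \<open>A structured subgraph\<close>

lemma card_uniform_family_le:
  assumes "finite V" "\<And>e. e \<in> A \<Longrightarrow> e \<subseteq> V \<and> card e = k"
  shows "card A \<le> card V ^ k"
proof -
  have "card A \<le> card {e. e \<subseteq> V \<and> card e = k}"
    using assms by (intro card_mono) auto
  also have "\<dots> = card V choose k" using assms(1) by (rule n_subsets)
  also have "\<dots> \<le> card V ^ k"
    by (cases "k \<le> card V") (simp_all add: binomial_le_pow binomial_eq_0)
  finally show ?thesis .
qed

lemma card_Union_le_largest_class:
  assumes "finite A" "\<And>e. e \<in> A \<Longrightarrow> bij_betw \<chi> e {..<r}"
    and "\<And>j. j < r \<Longrightarrow> card (proj \<chi> {j} ` A) \<le> N"
  shows "card (\<Union>A) \<le> r * N"
proof -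
  have c1: "card S = 1" if "S \<in> proj \<chi> {j} ` A" "j < r" for S j
    using that assms(2) card_proj[of \<chi> _ r "{j}"] by force
  have "\<Union>A \<subseteq> (\<Union>j\<in>{..<r}. \<Union>(proj \<chi> {j} ` A))"
  proof
    fix x assume "x \<in> \<Union>A"
    then obtain e where e: "e \<in> A" "x \<in> e" by auto
    then have "\<chi> x < r" using assms(2) by (auto simp: bij_betw_def)
    moreover have "x \<in> proj \<chi> {\<chi> x} e" using e by (simp add: proj_def)
    ultimately show "x \<in> (\<Union>j\<in>{..<r}. \<Union>(proj \<chi> {j} ` A))" using e by blast
  qed
  moreover have fin: "finite (\<Union>(proj \<chi> {j} ` A))" if "j < r" for j
    using assms(1) c1[OF _ that] by (intro finite_Union) (auto intro: card_ge_0_finite)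
  ultimately have "card (\<Union>A) \<le> card (\<Union>j\<in>{..<r}. \<Union>(proj \<chi> {j} ` A))"
    by (intro card_mono) auto
  also have "\<dots> \<le> (\<Sum>j\<in>{..<r}. card (\<Union>(proj \<chi> {j} ` A)))"
    by (intro card_UN_le) auto
  also have "\<dots> \<le> (\<Sum>j\<in>{..<r}. N)"
  proof (rule sum_mono)
    fix j assume j: "j \<in> {..<r}"
    have "card (\<Union>(proj \<chi> {j} ` A)) \<le> (\<Sum>S\<in>proj \<chi> {j} ` A. card S)"
      using assms(1) by (intro card_Union_le_sum_card)
    also have "\<dots> = card (proj \<chi> {j} ` A)" using c1 j by simp
    finally show "card (\<Union>(proj \<chi> {j} ` A)) \<le> N" using assms(3)[of j] j by simp
  qed
  finally show ?thesis by simp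
qed

text \<open>The host is refined through \<open>H0\<close> (rainbow), \<open>H1\<close> (regular), \<open>H2\<close> (large codegrees) to the final \<open>A\<close>, in which
also the degrees of the \<open>I\<close>-projections are bounded from below. The last refinement keeps or deletes all
edges with the same \<open>I\<close>-projection together. Hence it does not change the degrees of the surviving
\<open>I\<close>-projections, nor the codegrees for colours outside \<open>I\<close>, which are the only ones needed for extending
\<open>I\<close>-projections. The parameters \<open>P\<close> and \<open>Q\<close> measure regularity and the loss of edges.\<close>

lemma structured_subgraph:
  fixes H :: "'b hypergraph" and r r0 K \<Lambda> :: nat and P Q :: real
  assumes H: "rgraph r H" and r: "1 \<le> r0" "r0 < r" and ne: "edges H \<noteq> {}"
    and \<Lambda>: "card (edges H) < 2 ^ \<Lambda>"
    and P: "P = 4 * real \<Lambda> ^ (2 ^ r)" and Q: "Q = 2 * real r ^ r * real \<Lambda> ^ (2 ^ r)"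
    and big: "Q * (real r * real K * real (card (verts H)) ^ (r - 1)) \<le> real (card (edges H))"
  obtains \<chi> I A U d where "A \<subseteq> edges H" "A \<noteq> {}" "\<And>e. e \<in> A \<Longrightarrow> bij_betw \<chi> e {..<r}"
    "I \<subseteq> {..<r}" "card I = r0" "U \<subseteq> verts H" "\<Union>A \<subseteq> U" "0 < d"
    "\<And>e. e \<in> A \<Longrightarrow> d \<le> real (card {e' \<in> A. proj \<chi> I e' = proj \<chi> I e})"
    "\<And>e. e \<in> A \<Longrightarrow> real (card {e' \<in> A. proj \<chi> I e' = proj \<chi> I e}) \<le> 2 * P * d"
    "\<And>j e. j \<in> {..<r} - I \<Longrightarrow> e \<in> A \<Longrightarrow>
       K \<le> card {e' \<in> A. proj \<chi> ({..<r} - {j}) e' = proj \<chi> ({..<r} - {j}) e}"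
    "real (card (edges H)) \<le> Q * real (card U) ^ r"
    "real (card (edges H)) \<le> 4 * P * Q * (real (card (proj \<chi> I ` A)) * d)"
    "(real (card U) / real r) powr ((real r - real r0) / (real r - 1))
       * (real (card (edges H)) / Q) powr ((real r0 - 1) / (real r - 1))
     \<le> (32 * P ^ 3) ^ (r0 - 1) * (2 * P) * real (card (proj \<chi> I ` A))"
proof -
  define m where "m = real (card (edges H))"
  have fH: "finite (verts H)" and eH: "\<And>e. e \<in> edges H \<Longrightarrow> e \<subseteq> verts H \<and> card e = r"
    using H by (auto simp: rgraph_def)
  have finE: "finite (edges H)" using fH eH by (auto intro: finite_subset[of _ "Pow (verts H)"])
  have mpos: "m > 0" using ne finE by (simp add: m_def card_gt_0_iff)
  define a where "a = real \<Lambda> ^ (2 ^ r)"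
  have "\<Lambda> \<ge> 1"
  proof (rule ccontr)
    assume "\<not> \<Lambda> \<ge> 1"
    then have "\<Lambda> = 0" by simp
    then show False using \<Lambda> mpos by (simp add: m_def)
  qed
  then have a1: "a \<ge> 1" by (simp add: a_def)
  have P1: "P \<ge> 1" and Pa: "P = 4 * a" and Qa: "Q = 2 * real r ^ r * a"
    using a1 P Q by (auto simp: a_def)
  have Qpos: "Q > 0" using r a1 by (simp add: Qa)
  obtain \<chi> where \<chi>: "card (edges H) \<le> r ^ r * card {e \<in> edges H. bij_betw \<chi> e {..<r}}"
    using rainbow_subfamily[OF fH _ eH, of "edges H"] r by auto
  define H0 where "H0 = {e \<in> edges H. bij_betw \<chi> e {..<r}}"
  have H0: "finite H0" "H0 \<subseteq> edges H" "card H0 < 2 ^ \<Lambda>"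
    using finE \<Lambda> card_mono[OF finE, of H0] by (auto simp: H0_def)
  have m0: "m \<le> real r ^ r * real (card H0)"
    using of_nat_mono[OF \<chi>, where 'a = real] by (simp add: H0_def m_def)
  obtain H1 where H1: "H1 \<subseteq> H0" "card H0 \<le> \<Lambda> ^ card (Pow {..<r}) * card H1"
    "\<And>J e. J \<in> Pow {..<r} \<Longrightarrow> e \<in> H1 \<Longrightarrow>
       card {e' \<in> H1. proj \<chi> J e' = proj \<chi> J e} * card (proj \<chi> J ` H1) \<le> 2 * card H0"
    using dyadic_regularisation[OF H0(1) _ H0(3), of "Pow {..<r}" "proj \<chi>"] by auto
  have m1: "real (card H0) \<le> a * real (card H1)"
    using of_nat_mono[OF H1(2), where 'a = real] by (simp add: a_def card_Pow)
  have finH1: "finite H1" using H1(1) H0(1) by (rule finite_subset)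
  obtain H2 where H2: "H2 \<subseteq> H1"
    "\<And>j e. j \<in> {..<r} \<Longrightarrow> e \<in> H2 \<Longrightarrow>
      K \<le> card {e' \<in> H2. proj \<chi> ({..<r} - {j}) e' = proj \<chi> ({..<r} - {j}) e}"
    "card H1 \<le> card H2 + K * (\<Sum>j\<in>{..<r}. card (proj \<chi> ({..<r} - {j}) ` H1))"
    using min_degree_subfamily[OF finH1, of "{..<r}" K "\<lambda>j. proj \<chi> ({..<r} - {j})"] by auto
  have rainbow: "bij_betw \<chi> e {..<r}" if "e \<in> H1" for e using that H1 by (auto simp: H0_def)
  have "card (proj \<chi> ({..<r} - {j}) ` H1) \<le> card (verts H) ^ (r - 1)" if "j < r" for j
  proof (rule card_uniform_family_le[OF fH])
    fix S assume "S \<in> proj \<chi> ({..<r} - {j}) ` H1"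
    then obtain e where e: "e \<in> H1" "S = proj \<chi> ({..<r} - {j}) e" by auto
    have "card S = card ({..<r} - {j})" unfolding e(2) by (rule card_proj[OF rainbow[OF e(1)]]) auto
    moreover have "S \<subseteq> e" using e by (auto simp: proj_def)
    ultimately show "S \<subseteq> verts H \<and> card S = r - 1"
      using eH e(1) H1(1) H0(2) that by auto
  qed
  then have "(\<Sum>j\<in>{..<r}. card (proj \<chi> ({..<r} - {j}) ` H1)) \<le> (\<Sum>j\<in>{..<r}. card (verts H) ^ (r - 1))"
    by (intro sum_mono) auto
  then have "K * (\<Sum>j\<in>{..<r}. card (proj \<chi> ({..<r} - {j}) ` H1)) \<le> K * (r * card (verts H) ^ (r - 1))"
    by (intro mult_le_mono2) simp
  then have "card H1 \<le> card H2 + K * (r * card (verts H) ^ (r - 1))"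
    using H2(3) by linarith
  then have "real (card H1) \<le> real (card H2 + K * (r * card (verts H) ^ (r - 1)))"
    by (rule of_nat_mono)
  then have l1: "real (card H1) \<le> real (card H2) + real r * real K * real (card (verts H)) ^ (r - 1)"
    by (simp add: mult_ac)
  have m01: "2 * m \<le> Q * real (card H1)"
    using order_trans[OF m0 mult_left_mono[OF m1, of "real r ^ r"]] by (simp add: Qa)
  have "Q * (2 * (real r * real K * real (card (verts H)) ^ (r - 1))) \<le> Q * real (card H1)"
    using big m01 unfolding m_def by linarith
  then have "2 * (real r * real K * real (card (verts H)) ^ (r - 1)) \<le> real (card H1)"
    using Qpos by simp
  then have l2: "real (card H1) \<le> 2 * real (card H2)" using l1 by linarith
  have m2: "m \<le> Q * real (card H2)"
  proof -
    have "Q * real (card H1) \<le> Q * (2 * real (card H2))"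
      using l2 Qpos by (intro mult_left_mono) auto
    then show ?thesis using m01 by linarith
  qed
  have finH2: "finite H2" using H2(1) finH1 by (rule finite_subset)
  have neH2: "H2 \<noteq> {}" using m2 mpos by auto
  have H2rb: "bij_betw \<chi> e {..<r}" if "e \<in> H2" for e using that H2(1) rainbow by auto
  have reg: "real (card {e' \<in> H2. proj \<chi> J e' = proj \<chi> J e}) * real (card (proj \<chi> J ` H2)) \<le> P * real (card H2)"
    if J: "J \<subseteq> {..<r}" and e: "e \<in> H2" for J e
  proof -
    have "card {e' \<in> H2. proj \<chi> J e' = proj \<chi> J e} * card (proj \<chi> J ` H2)
      \<le> card {e' \<in> H1. proj \<chi> J e' = proj \<chi> J e} * card (proj \<chi> J ` H1)"
      using H2(1) finH1 by (intro mult_le_mono card_mono) auto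
    also have "\<dots> \<le> 2 * card H0" using H1(3) J e H2(1) by auto
    finally have "real (card {e' \<in> H2. proj \<chi> J e' = proj \<chi> J e} * card (proj \<chi> J ` H2)) \<le> real (2 * card H0)"
      by (rule of_nat_mono)
    also have "\<dots> \<le> 2 * (a * real (card H1))" using m1 by simp
    also have "\<dots> \<le> 2 * (a * (2 * real (card H2)))"
      using l2 a1 by (intro mult_left_mono) auto
    finally show ?thesis by (simp add: Pa)
  qed
  define s where "s J = real (card (proj \<chi> J ` H2))" for J
  have spos: "s J > 0" for J using finH2 neH2 by (simp add: s_def card_gt_0_iff)
  \<comment> \<open>Starting the greedy choice at the largest colour class makes the exponent of the number of vertices
    work: this class has at least \<open>card U / r\<close> vertices.\<close>
  define N where "N = Max ((\<lambda>j. card (proj \<chi> {j} ` H2)) ` {..<r})"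
  have "N \<in> (\<lambda>j. card (proj \<chi> {j} ` H2)) ` {..<r}"
    unfolding N_def using r by (intro Max_in) auto
  then obtain j0 where j0: "j0 < r" "card (proj \<chi> {j0} ` H2) = N" by auto
  define U where "U = \<Union>H2"
  have "card U \<le> r * N"
    unfolding U_def
    by (rule card_Union_le_largest_class[OF finH2 H2rb]) (auto simp: N_def intro!: Max_ge)
  then have "real (card U) \<le> real (r * N)" by (rule of_nat_mono)
  then have U1: "real (card U) / real r \<le> s {j0}"
    using r j0(2) by (simp add: s_def field_simps)
  have U2: "U \<subseteq> verts H" using eH H0(2) H1(1) H2(1) by (fastforce simp: U_def)
  have finU: "finite U" using U2 fH by (rule finite_subset)
  have "card H2 \<le> card U ^ r"
  proof (rule card_uniform_family_le[OF finU])
    show "e \<subseteq> U \<and> card e = r" if "e \<in> H2" for e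
      using that eH H0(2) H1(1) H2(1) by (auto simp: U_def)
  qed
  then have U3: "m \<le> Q * real (card U) ^ r"
  proof -
    have "real (card H2) \<le> real (card U) ^ r"
      using of_nat_mono[OF \<open>card H2 \<le> card U ^ r\<close>, where 'a = real] by simp
    then have "Q * real (card H2) \<le> Q * real (card U) ^ r"
      using Qpos by (intro mult_left_mono) auto
    then show ?thesis using m2 by linarith
  qed
  obtain I where I: "I \<subseteq> {..<r}" "card I = r0"
    "s {j0} powr ((real r - real r0) / (real r - 1)) * real (card H2) powr ((real r0 - 1) / (real r - 1))
     \<le> (32 * P ^ 3) ^ (r0 - 1) * s I"
  proof -
    have "r0 \<le> r" "2 \<le> r" using r by auto
    then show thesis
      using large_projection[OF finH2 neH2 H2rb P1 reg r(1) _ _ j0(1), of thesis] that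
      unfolding s_def by blast
  qed
  \<comment> \<open>Half of the average degree of an \<open>I\<close>-projection, so that at most half of the edges get lost.\<close>
  define d where "d = real (card H2) / (2 * s I)"
  have cH2: "real (card H2) > 0" using finH2 neH2 by (simp add: card_gt_0_iff)
  have dpos: "d > 0" using cH2 spos[of I] by (simp add: d_def)
  have ds: "2 * (d * s I) = real (card H2)" using spos[of I] by (simp add: d_def)
  define A where "A = {e \<in> H2. d \<le> real (card {e' \<in> H2. proj \<chi> I e' = proj \<chi> I e})}"
  have AH2: "A \<subseteq> H2" "finite A" using finH2 by (auto simp: A_def)
  have closed: "e' \<in> A" if "e \<in> A" "e' \<in> H2" "proj \<chi> I e' = proj \<chi> I e" for e e'
    using that by (simp add: A_def)
  have fib: "{e' \<in> A. proj \<chi> I e' = proj \<chi> I e} = {e' \<in> H2. proj \<chi> I e' = proj \<chi> I e}" if "e \<in> A" for e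
    using closed[OF that] AH2(1) by blast
  have "card H2 \<le> card (A \<union> {e \<in> H2. real (card {e' \<in> H2. proj \<chi> I e' = proj \<chi> I e}) < d})"
    using finH2 by (intro card_mono) (auto simp: A_def)
  then have "card H2 \<le> card A + card {e \<in> H2. real (card {e' \<in> H2. proj \<chi> I e' = proj \<chi> I e}) < d}"
    using card_Un_le order_trans by blast
  moreover have "real (card {e \<in> H2. real (card {e' \<in> H2. proj \<chi> I e' = proj \<chi> I e}) < d}) \<le> d * s I"
    unfolding s_def using dpos by (intro card_low_degree finH2) simp
  ultimately have cA: "real (card H2) / 2 \<le> real (card A)" using ds by linarith
  have neA: "A \<noteq> {}" using cA cH2 by auto
  have up: "real (card {e' \<in> A. proj \<chi> I e' = proj \<chi> I e}) \<le> 2 * P * d" if e: "e \<in> A" for e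
  proof -
    have "real (card {e' \<in> H2. proj \<chi> I e' = proj \<chi> I e}) * s I \<le> 2 * P * d * s I"
      using reg[OF I(1)] e AH2(1) ds unfolding s_def[symmetric] by (auto simp: algebra_simps)
    then show ?thesis using spos[of I] fib[OF e] by simp
  qed
  define g where "g = real (card (proj \<chi> I ` A))"
  have "real (card A) \<le> g * (2 * P * d)"
  proof -
    have "real (card A) = (\<Sum>S\<in>proj \<chi> I ` A. real (card {e \<in> A. proj \<chi> I e = S}))"
      by (subst card_eq_sum_fibres[OF AH2(2), of "proj \<chi> I"]) simp
    also have "\<dots> \<le> (\<Sum>S\<in>proj \<chi> I ` A. 2 * P * d)"
      using up by (intro sum_mono) auto
    finally show ?thesis by (simp add: g_def)
  qed
  then have H2g: "real (card H2) \<le> 4 * P * (g * d)" using cA by (simp add: algebra_simps)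
  have "d * s I \<le> d * (2 * P * g)" using H2g ds by (simp add: algebra_simps)
  then have sg: "s I \<le> 2 * P * g" using dpos by simp
  have e1: "m \<le> 4 * P * Q * (g * d)"
    using order_trans[OF m2 mult_left_mono[OF H2g, of Q]] Qpos by (simp add: mult_ac)
  have "(real (card U) / real r) powr ((real r - real r0) / (real r - 1)) * (m / Q) powr ((real r0 - 1) / (real r - 1))
    \<le> s {j0} powr ((real r - real r0) / (real r - 1)) * real (card H2) powr ((real r0 - 1) / (real r - 1))"
    using U1 m2 mpos Qpos r by (intro mult_mono powr_mono2) (auto simp: field_simps)
  also have "\<dots> \<le> (32 * P ^ 3) ^ (r0 - 1) * s I" by (rule I(3))
  also have "\<dots> \<le> (32 * P ^ 3) ^ (r0 - 1) * (2 * P * g)"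
    using sg P1 by (intro mult_left_mono) auto
  finally have e2: "(real (card U) / real r) powr ((real r - real r0) / (real r - 1)) * (m / Q) powr ((real r0 - 1) / (real r - 1))
    \<le> (32 * P ^ 3) ^ (r0 - 1) * (2 * P) * g" by (simp add: mult_ac)
  have cod: "K \<le> card {e' \<in> A. proj \<chi> ({..<r} - {j}) e' = proj \<chi> ({..<r} - {j}) e}"
    if j: "j \<in> {..<r} - I" and e: "e \<in> A" for j e
  proof -
    have IJ: "I \<inter> ({..<r} - {j}) = I" using I(1) j by auto
    have "e' \<in> A" if "e' \<in> H2" "proj \<chi> ({..<r} - {j}) e' = proj \<chi> ({..<r} - {j}) e" for e'
    proof (rule closed[OF e that(1)])
      show "proj \<chi> I e' = proj \<chi> I e"
        using arg_cong[OF that(2), of "proj \<chi> I"] unfolding proj_proj IJ .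
    qed
    then have "{e' \<in> H2. proj \<chi> ({..<r} - {j}) e' = proj \<chi> ({..<r} - {j}) e}
      = {e' \<in> A. proj \<chi> ({..<r} - {j}) e' = proj \<chi> ({..<r} - {j}) e}"
      using AH2(1) by blast
    then show ?thesis using H2(2)[of j e] j e AH2(1) by auto
  qed
  show thesis
  proof (rule that[of A \<chi> I U d])
    show "A \<subseteq> edges H" using AH2(1) H2(1) H1(1) H0(2) by blast
    show "\<Union>A \<subseteq> U" using AH2(1) by (auto simp: U_def)
    show "d \<le> real (card {e' \<in> A. proj \<chi> I e' = proj \<chi> I e})" if "e \<in> A" for e
      using that fib[OF that] by (simp add: A_def)
    show "bij_betw \<chi> e {..<r}" if "e \<in> A" for e using that AH2(1) H2rb by auto
  qed (fact neA I(1) I(2) U2 dpos up cod U3[unfolded m_def] e1[unfolded m_def g_def]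
      e2[unfolded m_def g_def])+
qed


section \<open>Balancedness of the expansion\<close>

text \<open>The degree bound for the lifted collection. Here \<open>g\<close> and \<open>m\<close> are the numbers of edges of the shadow and of the
host, and \<open>m \<le> R * (g * d)\<close> lets each of the \<open>i\<close> factors \<open>1 / g\<close> be traded for \<open>R * d / m\<close>; together
with the \<open>k - i\<close> free extensions this makes up the full power \<open>d ^ k\<close>, which the lower bound on the number
\<open>cD\<close> of lifted copies absorbs.\<close>

lemma degree_bound_transfer:
  fixes P Q R d g m \<tau>0 \<gamma>0 cC cD :: real
  assumes i: "1 \<le> i" "i \<le> k" and R: "R = 4 * P * Q" and "1 \<le> P" "1 \<le> Q"
    and pos: "0 < d" "0 < g" "0 < m" "0 \<le> \<tau>0" "0 \<le> \<gamma>0" "0 \<le> cC"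
    and cC: "cC * (d / 2) ^ k \<le> cD" and m: "m \<le> R * (g * d)"
  shows "\<gamma>0 * cC / g * (\<tau>0 / g) ^ (i - 1) * (2 * P * d) ^ (k - i)
    \<le> (2 * R) ^ k * \<gamma>0 * cD / m * (\<tau>0 / m) ^ (i - 1)"
proof -
  have Rpos: "R > 0" and PR: "2 * P \<le> R"
    using assms mult_left_mono[of 1 Q "4 * P"] by auto
  obtain l where l: "i = Suc l" using i by (cases i) auto
  have inv: "1 / g \<le> R * d / m" using m pos by (simp add: field_simps)
  have "\<gamma>0 * cC / g * (\<tau>0 / g) ^ (i - 1) * (2 * P * d) ^ (k - i)
    = \<gamma>0 * cC * \<tau>0 ^ l * ((1 / g) ^ i * (2 * P * d) ^ (k - i))"
    by (simp add: l power_divide)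
  also have "\<dots> \<le> \<gamma>0 * cC * \<tau>0 ^ l * ((R * d / m) ^ i * (R * d) ^ (k - i))"
    using inv PR pos Rpos \<open>1 \<le> P\<close>
    by (intro mult_left_mono mult_mono power_mono mult_right_mono mult_nonneg_nonneg zero_le_power) auto
  also have "(R * d / m) ^ i * (R * d) ^ (k - i) = (R * d) ^ k / m ^ i"
    using i by (simp add: power_divide flip: power_add)
  also have "(R * d) ^ k = (2 * R) ^ k * (d / 2) ^ k"
    unfolding power_mult_distrib[symmetric] by simp
  also have "\<gamma>0 * cC * \<tau>0 ^ l * ((2 * R) ^ k * (d / 2) ^ k / m ^ i)
    = (2 * R) ^ k * \<gamma>0 * \<tau>0 ^ l / m ^ i * (cC * (d / 2) ^ k)" by simp
  also have "\<dots> \<le> (2 * R) ^ k * \<gamma>0 * \<tau>0 ^ l / m ^ i * cD"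
    using cC pos Rpos by (intro mult_left_mono divide_nonneg_nonneg mult_nonneg_nonneg zero_le_power) auto
  also have "\<dots> = (2 * R) ^ k * \<gamma>0 * cD / m * (\<tau>0 / m) ^ (i - 1)"
    by (simp add: l power_divide)
  finally show ?thesis .
qed

text \<open>The statement for a single host graph. All losses are bounded by powers of \<open>B\<close>, a fixed power of \<open>ln n\<close>
that dominates \<open>P\<close>, \<open>Q\<close> and the constants depending on \<open>F\<close> and \<open>r\<close>; the exponent in \<open>LC\<close> adds up what
the individual estimates need. The term with the factor \<open>r - 1\<close> is there because in the
comparison of the shadow with \<open>M\<close> the factor \<open>LC\<close> only enters with the power \<open>\<beta> \<ge> 1 / (r - 1)\<close>.\<close>

lemma balanced_lift:
  fixes F :: "'a hypergraph" and H :: "nat hypergraph" and M \<gamma> :: "real \<Rightarrow> real"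
    and \<tau> :: "real \<Rightarrow> real \<Rightarrow> real" and r0 r N0 :: nat
  defines "\<alpha> \<equiv> (real r - real r0) / (real r - 1)" and "\<beta> \<equiv> (real r0 - 1) / (real r - 1)"
    and "a \<equiv> 2 ^ r :: nat" and "k \<equiv> card (edges F)"
    and "K \<equiv> 2 * r * (card (verts F) + r * card (edges F)) + 1"
  assumes r0: "2 \<le> r0" "r0 < r" and F: "rgraph r0 F"
    and Mpos: "\<And>n. n > 0 \<Longrightarrow> M n > 0" and \<gamma>pos: "\<And>n. n > 0 \<Longrightarrow> \<gamma> n > 0"
    and \<tau>pos: "\<And>n m. n > 0 \<Longrightarrow> m > 0 \<Longrightarrow> \<tau> n m > 0"
    and bal: "\<And>n (H :: nat hypergraph). N0 \<le> n \<Longrightarrow> rgraph r0 H \<Longrightarrow> card (verts H) = n \<Longrightarrow>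
       M (real n) \<le> real (card (edges H)) \<Longrightarrow>
       \<exists>\<C>. \<C> \<noteq> {} \<and> \<C> \<subseteq> copies F H \<and> (\<forall>i\<in>{1..k}.
         real (max_deg i \<lparr>verts = edges H, edges = \<C>\<rparr>)
           \<le> \<gamma> (real n) * real (card \<C>) / real (card (edges H))
              * (\<tau> (real n) (real (card (edges H))) / real (card (edges H))) ^ (i - 1))"
    and Mmono: "\<And>x y. real N0 \<le> x \<Longrightarrow> x \<le> y \<Longrightarrow> M x * x powr - \<alpha> \<le> M y * y powr - \<alpha>"
    and \<gamma>mono: "\<And>x y. real N0 \<le> x \<Longrightarrow> x \<le> y \<Longrightarrow> \<gamma> x \<le> \<gamma> y"
    and \<tau>anti: "\<And>n x y. real N0 \<le> n \<Longrightarrow> 0 < x \<Longrightarrow> x \<le> y \<Longrightarrow> \<tau> n y \<le> \<tau> n x"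
    and \<tau>mono: "\<And>n m x. real N0 \<le> n \<Longrightarrow> M n \<le> m \<Longrightarrow> 1 \<le> x \<Longrightarrow> \<tau> n m \<le> \<tau> (n * x) (m * x powr \<alpha>)"
    and N0: "1 \<le> N0"
    and H: "rgraph r H" and n: "n = card (verts H)" and m: "m = real (card (edges H))"
    and large: "real N0 ^ r < real n" "32 \<le> ln (real n)" "2 * real r ^ r \<le> ln (real n)"
      "2 * real r + 2 \<le> ln (real n)" "real K \<le> ln (real n)"
    and B: "B = ln (real n) ^ (2 * a + 1)" and LC: "LC = B ^ ((4 + 4 * r0) * (r - 1) + 4 * k + 3)"
    and mlarge: "max (M (real n) powr ((real r - 1) / (real r0 - 1)) * real n powr (- ((real r - real r0) / (real r0 - 1))))
        (real n powr (real r - 1)) * LC \<le> m"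
  obtains \<D> where "\<D> \<noteq> {}" "\<D> \<subseteq> copies (expansion r0 r F) H"
    "\<And>i. i \<in> {1..k} \<Longrightarrow> real (max_deg i \<lparr>verts = edges H, edges = \<D>\<rparr>)
       \<le> \<gamma> (real n) * LC * real (card \<D>) / m
         * (\<tau> (real n) (real n powr \<alpha> * m powr \<beta> * inverse LC) * LC / m) ^ (i - 1)"
proof -
  define L where "L = ln (real n)"
  define N where "N = real n"
  have npos: "N > 0" using large(1) N0 unfolding N_def by (metis less_le_trans of_nat_0_le_iff zero_le_power le_less_trans)
  have N1: "N \<ge> 1" using npos by (simp add: N_def)
  have L: "32 \<le> L" "2 * real r ^ r \<le> L" "2 * real r + 2 \<le> L" "real K \<le> L"
    using large by (auto simp: L_def)
  have ab: "\<alpha> + \<beta> = 1" "0 < \<beta>" "0 < \<alpha>" "\<alpha> \<le> 1" "\<beta> \<le> 1" "1 \<le> \<beta> * real (r - 1)"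
  proof -
    have x: "real r - 1 > 0" "real (r - 1) = real r - 1" using r0 by auto
    show "\<alpha> + \<beta> = 1" unfolding \<alpha>_def \<beta>_def add_divide_distrib[symmetric] using x by simp
    show "0 < \<beta>" "0 < \<alpha>" "\<alpha> \<le> 1" "\<beta> \<le> 1" "1 \<le> \<beta> * real (r - 1)"
      unfolding \<alpha>_def \<beta>_def x(2) using x r0 by (auto simp: divide_le_eq_1)
  qed
  have LB: "L \<le> B" unfolding B L_def[symmetric] using L by (intro self_le_power) auto
  have B1: "1 \<le> B" using LB L by linarith
  have LCge: "B ^ j \<le> LC" if "j \<le> (4 + 4 * r0) * (r - 1) + 4 * k + 3" for j
    unfolding LC using B1 that by (intro power_increasing) auto
  have LC1: "1 \<le> LC" using LCge[of 0] by simp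
  have fH: "finite (verts H)" and eH: "\<And>e. e \<in> edges H \<Longrightarrow> e \<subseteq> verts H \<and> card e = r"
    using H by (auto simp: rgraph_def)
  have mmax: "z * LC \<le> m" if "z \<le> max (M (real n) powr ((real r - 1) / (real r0 - 1))
      * real n powr (- ((real r - real r0) / (real r0 - 1)))) (real n powr (real r - 1))" for z
    using mult_right_mono[OF that, of LC] mlarge LC1 by linarith
  have mN: "N powr (real r - 1) * LC \<le> m" by (rule mmax) (simp add: N_def)
  have Npow: "N powr (real r - 1) = N ^ (r - 1)"
    using npos r0 by (simp add: of_nat_diff flip: powr_realpow)
  have mNk: "N ^ (r - 1) * LC \<le> m" using mN unfolding Npow .
  have mpos: "m > 0"
    using mNk npos LC1 by (smt (verit) mult_pos_pos zero_less_power)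
  \<comment> \<open>The number of dyadic scales: about \<open>r * log 2 n\<close> scales would do, and \<open>L ^ 2\<close> exceeds this for large \<open>n\<close>
    without any constant to carry along.\<close>
  define \<Lambda> where "\<Lambda> = nat \<lfloor>L ^ 2\<rfloor>"
  have \<Lambda>: "real \<Lambda> \<le> L ^ 2" "L ^ 2 - 1 < real \<Lambda>"
    unfolding \<Lambda>_def by (simp_all add: of_nat_nat)
  have "card (edges H) \<le> n ^ r"
    unfolding n using fH eH by (rule card_uniform_family_le)
  also have "n ^ r < 2 ^ \<Lambda>"
  proof -
    have "2 * real r * L + 1 < L ^ 2"
      using mult_right_mono[of "2 * real r + 2" L L] L by (simp add: power2_eq_square algebra_simps)
    moreover have ln2: "1 / 2 \<le> ln (2 :: real)"
      using ln_le_minus_one[of "1/2 :: real"] by (simp add: ln_div)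
    ultimately have "real r * L < real \<Lambda> * (1 / 2)" using \<Lambda>(2) by linarith
    also have "\<dots> \<le> real \<Lambda> * ln 2" using ln2 by (intro mult_left_mono) auto
    finally have "ln (N ^ r) < ln (2 ^ \<Lambda>)"
      using npos by (simp add: ln_realpow L_def N_def)
    then have "N ^ r < 2 ^ \<Lambda>" using npos by simp
    then show ?thesis unfolding N_def by (metis of_nat_less_iff of_nat_numeral of_nat_power)
  qed
  finally have \<Lambda>m: "card (edges H) < 2 ^ \<Lambda>" .
  define P where "P = 4 * real \<Lambda> ^ a"
  define Q where "Q = 2 * real r ^ r * real \<Lambda> ^ a"
  have \<Lambda>a: "1 \<le> real \<Lambda> ^ a" "real \<Lambda> ^ a \<le> L ^ (2 * a)"
  proof -
    have "32 * 32 \<le> L ^ 2" unfolding power2_eq_square using L by (intro mult_mono) auto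
    then have "1 \<le> real \<Lambda>" using \<Lambda>(2) by linarith
    then show "1 \<le> real \<Lambda> ^ a" by simp
    show "real \<Lambda> ^ a \<le> L ^ (2 * a)" unfolding power_mult using \<Lambda>(1) by (intro power_mono) auto
  qed
  have P: "1 \<le> P" "P \<le> B"
  proof -
    show "1 \<le> P" using \<Lambda>a by (simp add: P_def)
    have "P \<le> L * L ^ (2 * a)" unfolding P_def using \<Lambda>a L by (intro mult_mono) auto
    then show "P \<le> B" by (simp add: B L_def)
  qed
  have rr: "1 \<le> real r ^ r" using r0 by simp
  have Q: "1 \<le> Q" "Q \<le> B"
  proof -
    have "1 * 1 \<le> 2 * real r ^ r * real \<Lambda> ^ a"
      using \<Lambda>a rr by (intro mult_mono) auto
    then show "1 \<le> Q" by (simp add: Q_def)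
    have "Q \<le> L * L ^ (2 * a)" unfolding Q_def using \<Lambda>a L rr by (intro mult_mono) auto
    then show "Q \<le> B" by (simp add: B L_def)
  qed
  have rB: "real r \<le> B" "real K \<le> B" "32 \<le> B" using L LB by linarith+
  have big: "Q * (real r * real K * real (card (verts H)) ^ (r - 1)) \<le> real (card (edges H))"
  proof -
    have "Q * (real r * real K) \<le> B * (B * B)"
      using Q rB B1 by (intro mult_mono) auto
    also have "\<dots> = B ^ 3" by (simp add: power3_eq_cube)
    also have "\<dots> \<le> LC" by (intro LCge) simp
    finally have "N ^ (r - 1) * (Q * (real r * real K)) \<le> N ^ (r - 1) * LC"
      using npos by (intro mult_left_mono) auto
    then show ?thesis using mNk by (simp add: m n N_def mult_ac)
  qed
  have ne: "edges H \<noteq> {}" using mpos m by auto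
  obtain \<chi> I A U d where A: "A \<subseteq> edges H" "A \<noteq> {}" "\<And>e. e \<in> A \<Longrightarrow> bij_betw \<chi> e {..<r}"
    and I: "I \<subseteq> {..<r}" "card I = r0" and U: "U \<subseteq> verts H" "\<Union>A \<subseteq> U" and d: "0 < d"
    "\<And>e. e \<in> A \<Longrightarrow> d \<le> real (card {e' \<in> A. proj \<chi> I e' = proj \<chi> I e})"
    "\<And>e. e \<in> A \<Longrightarrow> real (card {e' \<in> A. proj \<chi> I e' = proj \<chi> I e}) \<le> 2 * P * d"
    and cod: "\<And>j e. j \<in> {..<r} - I \<Longrightarrow> e \<in> A \<Longrightarrow>
       K \<le> card {e' \<in> A. proj \<chi> ({..<r} - {j}) e' = proj \<chi> ({..<r} - {j}) e}"
    and bounds: "m \<le> Q * real (card U) ^ r"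
    "m \<le> 4 * P * Q * (real (card (proj \<chi> I ` A)) * d)"
    "(real (card U) / real r) powr \<alpha> * (m / Q) powr \<beta>
     \<le> (32 * P ^ 3) ^ (r0 - 1) * (2 * P) * real (card (proj \<chi> I ` A))"
  proof (rule structured_subgraph[OF H _ r0(2) ne \<Lambda>m P_def[unfolded a_def] Q_def[unfolded a_def] big])
    show "1 \<le> r0" using r0 by simp
  qed (rule that[unfolded m \<alpha>_def \<beta>_def]; (assumption | blast))
  define g where "g = real (card (proj \<chi> I ` A))"
  define u where "u = real (card U)"
  have finU: "finite U" using U(1) fH by (rule finite_subset)
  have finA: "finite A" using A(1) finite_edges[OF H] by (rule finite_subset)
  have gpos: "g > 0" using finA A(2) by (simp add: g_def card_gt_0_iff)
  have un: "u \<le> N" using card_mono[OF fH U(1)] by (simp add: u_def N_def n)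
  \<comment> \<open>The monotonicity hypotheses and balancedness apply to the smaller graph only if it is still large;
    it is, since \<open>H\<close> has too many edges to keep them within boundedly many vertices.\<close>
  have uN0: "real N0 \<le> u"
  proof (rule ccontr)
    assume "\<not> real N0 \<le> u"
    then have "Q * u ^ r \<le> LC * real N0 ^ r"
      using Q LCge[of 1] by (intro mult_mono power_mono) (auto simp: u_def)
    also have "\<dots> < LC * N" using large(1) LC1 by (simp add: N_def)
    also have "\<dots> \<le> LC * N ^ (r - 1)"
      using LC1 N1 r0 by (intro mult_left_mono self_le_power) auto
    finally show False using mNk bounds(1) by (simp add: u_def mult.commute)
  qed
  have upos: "u > 0" using uN0 N0 by linarith
  define R where "R = real r * Q * ((32 * P ^ 3) ^ (r0 - 1) * (2 * P))"
  have RB: "R \<le> B ^ (4 + 4 * r0)"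
  proof -
    have "32 * P ^ 3 \<le> B * B ^ 3" using P rB B1 by (intro mult_mono power_mono) auto
    then have "(32 * P ^ 3) ^ (r0 - 1) \<le> (B ^ 4) ^ (r0 - 1)"
      using P by (intro power_mono) (simp_all flip: power_Suc)
    moreover have "2 * P \<le> B * B" using P rB B1 by (intro mult_mono) auto
    ultimately have "(32 * P ^ 3) ^ (r0 - 1) * (2 * P) \<le> (B ^ 4) ^ (r0 - 1) * (B * B)"
      by (rule mult_mono) (use P B1 in auto)
    moreover have "real r * Q \<le> B * B" using rB Q B1 by (intro mult_mono) auto
    ultimately have "R \<le> (B * B) * ((B ^ 4) ^ (r0 - 1) * (B * B))"
      unfolding R_def by (intro mult_mono[of "real r * Q"]) (use P B1 in auto)
    also have "\<dots> = B ^ (4 + 4 * (r0 - 1))"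
    proof -
      have q: "B ^ 4 = (B * B) * (B * B)" by (simp add: eval_nat_numeral)
      show ?thesis unfolding power_add power_mult q by (simp only: mult_ac)
    qed
    also have "\<dots> \<le> B ^ (4 + 4 * r0)" using B1 by (intro power_increasing) auto
    finally show ?thesis .
  qed
  have Rpos: "R > 0" using r0 P Q by (simp add: R_def)
  have RLC: "R \<le> LC"
  proof -
    have "4 + 4 * r0 \<le> (4 + 4 * r0) * (r - 1)"
      using r0 mult_le_mono2[of 1 "r - 1" "4 + 4 * r0"] by simp
    then have "B ^ (4 + 4 * r0) \<le> LC" by (intro LCge trans_le_add1)
    then show ?thesis using RB by linarith
  qed
  have RLC\<beta>: "R \<le> LC powr \<beta>"
  proof -
    have "B ^ (4 + 4 * r0) = B powr real (4 + 4 * r0)" using B1 by (simp only: powr_realpow)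
    also have "\<dots> \<le> B powr (real ((4 + 4 * r0) * (r - 1)) * \<beta>)"
    proof (rule powr_mono[OF _ B1])
      have "real (4 + 4 * r0) * 1 \<le> real (4 + 4 * r0) * (\<beta> * real (r - 1))"
        by (rule mult_left_mono[OF ab(6)]) simp
      then show "real (4 + 4 * r0) \<le> real ((4 + 4 * r0) * (r - 1)) * \<beta>"
        unfolding of_nat_mult by (simp only: mult_1_left mult_1_right mult_ac)
    qed
    also have "\<dots> = (B ^ ((4 + 4 * r0) * (r - 1))) powr \<beta>"
      using B1 by (simp only: powr_realpow[symmetric] powr_powr)
    also have "\<dots> \<le> LC powr \<beta>"
      using ab B1 by (intro powr_mono2 LCge) auto
    finally show ?thesis using RB by linarith
  qed
  have gR: "u powr \<alpha> * m powr \<beta> \<le> R * g"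
  proof -
    have "real r powr \<alpha> \<le> real r powr 1" using r0 ab by (intro powr_mono) auto
    moreover have "Q powr \<beta> \<le> Q powr 1" using ab Q by (intro powr_mono) auto
    ultimately have rQ: "real r powr \<alpha> * Q powr \<beta> \<le> real r * Q"
      using r0 Q by (intro mult_mono) auto
    have "u powr \<alpha> * m powr \<beta> = (real r powr \<alpha> * Q powr \<beta>) * ((u / real r) powr \<alpha> * (m / Q) powr \<beta>)"
      using upos mpos Q r0 by (simp add: powr_divide)
    also have "\<dots> \<le> (real r * Q) * ((32 * P ^ 3) ^ (r0 - 1) * (2 * P) * g)"
      using bounds(3)
      by (intro mult_mono[OF rQ]) (use r0 Q in \<open>simp_all add: u_def g_def\<close>)
    finally show ?thesis by (simp add: R_def mult_ac)
  qed
  have Mg: "M u \<le> g"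
  proof -
    let ?z = "M N powr ((real r - 1) / (real r0 - 1)) * N powr (- ((real r - real r0) / (real r0 - 1)))"
    have MN: "M N > 0" using Mpos npos by simp
    have "?z * LC \<le> m" by (rule mmax) (simp add: N_def)
    then have "(?z * LC) powr \<beta> \<le> m powr \<beta>"
      using ab LC1 by (intro powr_mono2) auto
    moreover have "(?z * LC) powr \<beta> = M N * N powr - \<alpha> * LC powr \<beta>"
    proof -
      have "(real r - 1) / (real r0 - 1) * \<beta> = 1" "- ((real r - real r0) / (real r0 - 1)) * \<beta> = - \<alpha>"
      proof -
        have gen: "(x / p) * (p / x) = 1" "- (y / p) * (p / x) = - (y / x)"
          if "p \<noteq> 0" "x \<noteq> 0" for p x y :: real using that by simp_all
        have nz: "real r0 - 1 \<noteq> 0" "real r - 1 \<noteq> 0" using r0 by auto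
        show "(real r - 1) / (real r0 - 1) * \<beta> = 1" unfolding \<beta>_def by (rule gen(1)[OF nz])
        show "- ((real r - real r0) / (real r0 - 1)) * \<beta> = - \<alpha>"
          unfolding \<alpha>_def \<beta>_def by (rule gen(2)[OF nz])
      qed
      note exps = this
      have "(?z * LC) powr \<beta> = (M N powr ((real r - 1) / (real r0 - 1))) powr \<beta>
          * (N powr (- ((real r - real r0) / (real r0 - 1)))) powr \<beta> * LC powr \<beta>"
        using LC1 by (simp add: powr_mult)
      then show ?thesis unfolding powr_powr exps using MN by simp
    qed
    moreover have "M N * N powr - \<alpha> * R \<le> M N * N powr - \<alpha> * LC powr \<beta>"
      using MN by (intro mult_left_mono[OF RLC\<beta>]) simp
    ultimately have "M N * N powr - \<alpha> * R \<le> m powr \<beta>" by linarith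
    then have "u powr \<alpha> * (M N * N powr - \<alpha> * R) \<le> u powr \<alpha> * m powr \<beta>"
      by (intro mult_left_mono) auto
    then have "R * (u powr \<alpha> * (M N * N powr - \<alpha>)) \<le> R * g"
      using gR by (simp add: mult_ac)
    then have "u powr \<alpha> * (M N * N powr - \<alpha>) \<le> g" using Rpos by simp
    moreover have "u powr \<alpha> * (M u * u powr - \<alpha>) \<le> u powr \<alpha> * (M N * N powr - \<alpha>)"
      using Mmono[OF uN0 un] by (intro mult_left_mono) auto
    moreover have "u powr \<alpha> * (M u * u powr - \<alpha>) = M u" using upos by (simp add: powr_minus)
    ultimately show ?thesis by linarith
  qed
  define G where "G = \<lparr>verts = U, edges = proj \<chi> I ` A\<rparr>"
  have "rgraph r0 G"
    using finU U(2) card_proj[OF A(3) I(1)] I(2) by (auto simp: rgraph_def G_def proj_def)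
  then obtain \<C> where \<C>: "\<C> \<noteq> {}" "\<C> \<subseteq> copies F G"
    and \<C>deg: "\<And>i. i \<in> {1..k} \<Longrightarrow> real (max_deg i \<lparr>verts = edges G, edges = \<C>\<rparr>)
           \<le> \<gamma> u * real (card \<C>) / g * (\<tau> u g / g) ^ (i - 1)"
  proof -
    have "real (card (edges G)) = g" by (simp add: G_def g_def)
    note G_bal = bal[of "card U" G, unfolded this u_def[symmetric]]
    have "N0 \<le> card U" "card (verts G) = card U" using uN0 by (simp_all add: u_def G_def)
    from G_bal[OF this(1) \<open>rgraph r0 G\<close> this(2) Mg] show thesis using that by blast
  qed
  obtain \<D> where \<D>: "\<D> \<noteq> {}" "\<D> \<subseteq> copies (expansion r0 r F) H"
    "real (card \<C>) * (d / 2) ^ k \<le> real (card \<D>)"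
    "\<And>i. i \<in> {1..k} \<Longrightarrow> real (max_deg i \<lparr>verts = edges H, edges = \<D>\<rparr>)
      \<le> real (max_deg i \<lparr>verts = proj \<chi> I ` A, edges = \<C>\<rparr>) * (2 * P * d) ^ (k - i)"
  proof (rule lift_copies[OF F H _ r0(2) A(1) I A(3) U(1) \<C>(2)[unfolded G_def] \<C>(1) d])
    show "2 * r * (card (verts F) + r * card (edges F)) < card {e' \<in> A. proj \<chi> ({..<r} - {j}) e' = proj \<chi> ({..<r} - {j}) e}"
      if "j \<in> {..<r} - I" "e \<in> A" for j e
      using cod[OF that] by (simp add: K_def)
  qed (use r0 that in \<open>auto simp: k_def\<close>)
  have \<gamma>u: "0 < \<gamma> u" "\<gamma> u \<le> \<gamma> N" using \<gamma>pos upos \<gamma>mono[OF uN0 un] by auto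
  define T where "T = \<tau> N (N powr \<alpha> * m powr \<beta> * inverse LC)"
  have \<tau>u: "0 < \<tau> u g" "\<tau> u g \<le> T"
  proof -
    show "0 < \<tau> u g" using \<tau>pos upos gpos by simp
    \<comment> \<open>Both monotonicity hypotheses on \<open>\<tau>\<close> meet here: from \<open>u\<close> to \<open>n\<close> vertices, then down to fewer edges.\<close>
    define x where "x = N / u"
    have x: "1 \<le> x" "u * x = N" using un upos by (auto simp: x_def)
    have "\<tau> u g \<le> \<tau> N (g * x powr \<alpha>)" using \<tau>mono[OF uN0 Mg x(1)] by (simp add: x(2))
    also have "\<dots> \<le> T"
      unfolding T_def
    proof (rule \<tau>anti)
      show "real N0 \<le> N" using uN0 un by linarith
      show "0 < N powr \<alpha> * m powr \<beta> * inverse LC" using npos mpos LC1 by simp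
      have "N powr \<alpha> * m powr \<beta> = x powr \<alpha> * (u powr \<alpha> * m powr \<beta>)"
        using upos npos by (simp add: x_def powr_divide)
      also have "\<dots> \<le> x powr \<alpha> * (LC * g)"
        using order_trans[OF gR mult_right_mono[OF RLC, of g]] gpos by (intro mult_left_mono) auto
      finally have "N powr \<alpha> * m powr \<beta> \<le> LC * (g * x powr \<alpha>)" by (simp add: mult_ac)
      then show "N powr \<alpha> * m powr \<beta> * inverse LC \<le> g * x powr \<alpha>"
        using LC1 by (simp add: field_simps)
    qed
    finally show "\<tau> u g \<le> T" .
  qed
  have PQk: "(2 * (4 * P * Q)) ^ k \<le> LC"
  proof -
    have "8 * P * Q \<le> B * B * B" using P Q rB B1 by (intro mult_mono) auto
    then have "(2 * (4 * P * Q)) ^ k \<le> (B ^ 3) ^ k"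
      using P Q by (intro power_mono) (auto simp: power3_eq_cube)
    also have "\<dots> = B ^ (3 * k)" by (simp add: power_mult)
    also have "\<dots> \<le> LC" by (intro LCge) simp
    finally show ?thesis .
  qed
  have "real (max_deg i \<lparr>verts = edges H, edges = \<D>\<rparr>)
       \<le> \<gamma> N * LC * real (card \<D>) / m * (T * LC / m) ^ (i - 1)" if i: "i \<in> {1..k}" for i
  proof -
    have "real (max_deg i \<lparr>verts = edges H, edges = \<D>\<rparr>)
      \<le> real (max_deg i \<lparr>verts = proj \<chi> I ` A, edges = \<C>\<rparr>) * (2 * P * d) ^ (k - i)"
      by (rule \<D>(4)[OF i])
    also have "\<dots> \<le> \<gamma> u * real (card \<C>) / g * (\<tau> u g / g) ^ (i - 1) * (2 * P * d) ^ (k - i)"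
      using \<C>deg[OF i] P d(1) by (intro mult_right_mono) (auto simp: G_def)
    also have "\<dots> \<le> (2 * (4 * P * Q)) ^ k * \<gamma> u * real (card \<D>) / m * (\<tau> u g / m) ^ (i - 1)"
      by (rule degree_bound_transfer[where R = "4 * P * Q" and Q = Q])
        (use i P Q d(1) gpos mpos \<tau>u \<gamma>u \<D>(3) bounds(2) in \<open>simp_all add: g_def\<close>)
    also have "\<dots> \<le> LC * \<gamma> N * real (card \<D>) / m * (T * LC / m) ^ (i - 1)"
    proof -
      have "\<tau> u g * 1 \<le> T * LC" using \<tau>u LC1 by (intro mult_mono) auto
      then have "(\<tau> u g / m) ^ (i - 1) \<le> (T * LC / m) ^ (i - 1)"
        using \<tau>u mpos by (intro power_mono divide_right_mono) auto
      moreover have "(2 * (4 * P * Q)) ^ k * \<gamma> u * real (card \<D>) / m \<le> LC * \<gamma> N * real (card \<D>) / m"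
        using PQk \<gamma>u LC1 mpos by (intro divide_right_mono mult_right_mono mult_mono) auto
      ultimately show ?thesis
        using \<tau>u \<gamma>u mpos LC1
        by (intro mult_mono) (auto intro!: divide_nonneg_nonneg mult_nonneg_nonneg)
    qed
    finally show ?thesis by (simp add: mult_ac)
  qed
  then show thesis using that \<D>(1,2) unfolding N_def T_def by blast
qed


theorem theorem2p7:
  fixes F :: "'a hypergraph" and r0 r :: nat
  assumes "r0 \<ge> 2" and "r > r0" and "rgraph r0 F"
  shows "\<exists>C::real. C > 0 \<and>
    (\<forall>(M :: real \<Rightarrow> real) (\<gamma> :: real \<Rightarrow> real) (\<tau> :: real \<Rightarrow> real \<Rightarrow> real).
      (\<forall>n>0. M n > 0) \<and> (\<forall>n>0. \<gamma> n > 0) \<and> (\<forall>n>0. \<forall>m>0. \<tau> n m > 0) \<and>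
      balanced r0 M \<gamma> \<tau> F \<and>
      (\<exists>N. mono_on {N..} (\<lambda>n. M n * n powr (- ((real r - real r0) / (real r - 1))))) \<and>
      (\<exists>N. mono_on {N..} \<gamma>) \<and>
      (\<forall>\<^sub>F n in at_top.
         antimono_on {0<..} (\<lambda>m. \<tau> n m) \<and>
         (\<forall>m\<ge>M n. mono_on {1..} (\<lambda>x. \<tau> (n * x) (m * x powr ((real r - real r0) / (real r - 1))))))
      \<longrightarrow>
      balanced r
        (\<lambda>n. max (M n powr ((real r - 1) / (real r0 - 1))
                    * n powr (- ((real r - real r0) / (real r0 - 1))))
                 (n powr (real r - 1))
              * ln n powr C)
        (\<lambda>n. \<gamma> n * ln n powr C)
        (\<lambda>n m. \<tau> n (n powr ((real r - real r0) / (real r - 1))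
                      * m powr ((real r0 - 1) / (real r - 1)) * ln n powr (- C))
                * ln n powr C)
        (expansion r0 r F))"
proof -
  define k where "k = card (edges F)"
  define e where "e = (4 + 4 * r0) * (r - 1) + 4 * k + 3"
  define a :: nat where "a = 2 ^ r"
  define C where "C = real ((2 * a + 1) * e)"
  define \<alpha> where "\<alpha> = (real r - real r0) / (real r - 1)"
  define \<beta> where "\<beta> = (real r0 - 1) / (real r - 1)"
  have cE: "card (edges (expansion r0 r F)) = k"
    using card_edges_expansion[OF assms(2)] by (simp add: k_def)
  have "e > 0" by (simp add: e_def)
  then have "C > 0" unfolding C_def of_nat_0_less_iff by simp
  moreover have "balanced r
        (\<lambda>n. max (M n powr ((real r - 1) / (real r0 - 1))
                    * n powr (- ((real r - real r0) / (real r0 - 1))))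
                 (n powr (real r - 1))
              * ln n powr C)
        (\<lambda>n. \<gamma> n * ln n powr C)
        (\<lambda>n m. \<tau> n (n powr \<alpha> * m powr \<beta> * ln n powr (- C)) * ln n powr C)
        (expansion r0 r F)"
    if pos: "\<forall>n>0. M n > 0" "\<forall>n>0. \<gamma> n > 0" "\<forall>n>0. \<forall>m>0. \<tau> n m > 0"
      and bal: "balanced r0 M \<gamma> \<tau> F"
      and Mmono: "\<exists>N. mono_on {N..} (\<lambda>n. M n * n powr (- \<alpha>))"
      and \<gamma>mono: "\<exists>N. mono_on {N..} \<gamma>"
      and \<tau>: "\<forall>\<^sub>F n in at_top. antimono_on {0<..} (\<lambda>m. \<tau> n m) \<and>
         (\<forall>m\<ge>M n. mono_on {1..} (\<lambda>x. \<tau> (n * x) (m * x powr \<alpha>)))"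
    for M \<gamma> :: "real \<Rightarrow> real" and \<tau> :: "real \<Rightarrow> real \<Rightarrow> real"
  proof -
    obtain N1 where N1: "\<And>n (H :: nat hypergraph) m. N1 \<le> n \<Longrightarrow> rgraph r0 H \<Longrightarrow> card (verts H) = n \<Longrightarrow>
        card (edges H) = m \<Longrightarrow> M (real n) \<le> real m \<Longrightarrow>
        \<exists>\<C>. \<C> \<noteq> {} \<and> \<C> \<subseteq> copies F H \<and> (\<forall>i\<in>{1..k}.
          real (max_deg i \<lparr>verts = edges H, edges = \<C>\<rparr>)
            \<le> \<gamma> (real n) * real (card \<C>) / real m * (\<tau> (real n) (real m) / real m) ^ (i - 1))"
      using bal unfolding balanced_def eventually_sequentially k_def by blast
    obtain N2 where N2: "mono_on {N2..} (\<lambda>n. M n * n powr (- \<alpha>))" using Mmono by blast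
    obtain N3 where N3: "mono_on {N3..} \<gamma>" using \<gamma>mono by blast
    obtain N4 where N4: "\<And>n. N4 \<le> n \<Longrightarrow> antimono_on {0<..} (\<lambda>m. \<tau> n m)"
      "\<And>n m. N4 \<le> n \<Longrightarrow> M n \<le> m \<Longrightarrow> mono_on {1..} (\<lambda>x. \<tau> (n * x) (m * x powr \<alpha>))"
      using \<tau> unfolding eventually_at_top_linorder by blast
    define N0 where "N0 = max (max 1 N1) (nat \<lceil>max N2 (max N3 N4)\<rceil>)"
    have N0: "1 \<le> N0" "N1 \<le> N0" "N2 \<le> real N0" "N3 \<le> real N0" "N4 \<le> real N0"
    proof -
      have "max N2 (max N3 N4) \<le> real (nat \<lceil>max N2 (max N3 N4)\<rceil>)" by (rule real_nat_ceiling_ge)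
      also have "\<dots> \<le> real N0" by (simp add: N0_def)
      finally show "N2 \<le> real N0" "N3 \<le> real N0" "N4 \<le> real N0" by simp_all
    qed (simp_all add: N0_def)
    define K where "K = 2 * r * (card (verts F) + r * card (edges F)) + 1"
    define c where "c = Max {32, 2 * real r ^ r, 2 * real r + 2, real K}"
    have "\<forall>\<^sub>F n in sequentially. real N0 ^ r < real n"
      using filterlim_real_sequentially by (simp add: filterlim_at_top_dense)
    moreover have "\<forall>\<^sub>F n in sequentially. c \<le> ln (real n)"
      using filterlim_compose[OF ln_at_top filterlim_real_sequentially] by (simp add: filterlim_at_top)
    ultimately have large: "\<forall>\<^sub>F n in sequentially. real N0 ^ r < real n \<and> c \<le> ln (real n)"
      by (rule eventually_conj)
    show ?thesis
      unfolding balanced_def cE using large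
    proof (rule eventually_mono, intro allI impI, elim conjE)
      fix n m :: nat and H :: "nat hypergraph"
      assume n: "real N0 ^ r < real n" "c \<le> ln (real n)"
        and H: "rgraph r H" "card (verts H) = n" "card (edges H) = m"
        and m: "max (M (real n) powr ((real r - 1) / (real r0 - 1))
                    * real n powr (- ((real r - real r0) / (real r0 - 1))))
                 (real n powr (real r - 1)) * ln (real n) powr C \<le> real m"
      have c: "32 \<le> ln (real n)" "2 * real r ^ r \<le> ln (real n)" "2 * real r + 2 \<le> ln (real n)"
        "real K \<le> ln (real n)"
        using n(2) by (simp_all add: c_def)
      have LC: "ln (real n) powr C = (ln (real n) ^ (2 * a + 1)) ^ e"
        unfolding C_def power_mult[symmetric] using c(1) by (intro powr_realpow) linarith
      have inv: "ln (real n) powr (- C) = inverse (ln (real n) powr C)" by (rule powr_minus)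
      obtain \<D> where "\<D> \<noteq> {}" "\<D> \<subseteq> copies (expansion r0 r F) H"
        "\<And>i. i \<in> {1..k} \<Longrightarrow> real (max_deg i \<lparr>verts = edges H, edges = \<D>\<rparr>)
           \<le> \<gamma> (real n) * ln (real n) powr C * real (card \<D>) / real m
             * (\<tau> (real n) (real n powr \<alpha> * real m powr \<beta> * inverse (ln (real n) powr C))
                * ln (real n) powr C / real m) ^ (i - 1)"
        unfolding k_def \<alpha>_def \<beta>_def
      proof (rule balanced_lift[OF assms(1,2,3), where M = M and \<gamma> = \<gamma> and \<tau> = \<tau> and ?N0.0 = N0
            and H = H and n = n and m = "real m" and LC = "ln (real n) powr C"
            and B = "ln (real n) ^ (2 * a + 1)"], goal_cases)
        case (4 n H)
        then show ?case using N1[of n H] N0(2) by (auto simp: k_def)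
      next
        case (5 x y)
        then show ?case using N0(3) by (intro mono_onD[OF N2, unfolded \<alpha>_def]) auto
      next
        case (6 x y)
        then show ?case using N0(4) by (intro mono_onD[OF N3]) auto
      next
        case (7 n x y)
        then show ?case using N0(5) by (intro monotone_onD[OF N4(1), of n x y]) auto
      next
        case (8 n m x)
        then show ?case using N0(5) mono_onD[OF N4(2)[unfolded \<alpha>_def], of n m 1 x] by simp
      qed (use pos N0 H n c m in \<open>simp_all add: LC e_def a_def k_def K_def\<close>)
      then show "\<exists>\<C>. \<C> \<noteq> {} \<and> \<C> \<subseteq> copies (expansion r0 r F) H \<and>
          (\<forall>i\<in>{1..k}. real (max_deg i \<lparr>verts = edges H, edges = \<C>\<rparr>)
             \<le> \<gamma> (real n) * ln (real n) powr C * real (card \<C>) / real m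
               * (\<tau> (real n) (real n powr \<alpha> * real m powr \<beta> * ln (real n) powr (- C))
                  * ln (real n) powr C / real m) ^ (i - 1))"
        unfolding inv by blast
    qed
  qed
  ultimately show ?thesis unfolding \<alpha>_def \<beta>_def by (intro exI[of _ C]) blast
qed

end
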